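(* Let $k$ be an algebraically closed field of characteristic zero. Suppose that $G\simeq\mathfrak{D}_5$ (the dihedral group of order $10$) acts on $\mathbb{P}^4=\mathbb{P}(\mathrm{I}\oplus V_2\oplus V_2')$, where $\mathrm{I}$ is the trivial one-dimensional representation and $V_2$ and $V_2'$ are two nonisomorphic $2$-dimensional irreducible representations of $\mathfrak{D}_5$. Then the $G$-action on every $G$-invariant smooth quadric hypersurface in $\mathbb{P}^4$ is linearizable.
   Context: The action of $G$ on a threefold $Q$ is linearizable if $Q$ is $G$-equivariantly birational to $\mathbb{P}^3=\mathbb{P}(V)$ with action induced by a linear representation of $G$ on a $4$-dimensional vector space $V$. *)

theory Defs
  imports
    "HOL-Analysis.Analysis"
    "HOL-Algebra.Group"
    "HOL-Library.Poly_Mapping"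
    "HOL-Library.Numeral_Type"
    "HOL-Computational_Algebra.Polynomial"
begin

text \<open>The pair \<open>(a, b)\<close> stands for \<open>r\<^sup>a s\<^sup>b\<close>, where \<open>r\<^sup>n = s\<^sup>2 = 1\<close> and \<open>s r s = r\<^sup>-\<^sup>1\<close>.\<close>

definition dihedral_group :: "nat \<Rightarrow> (int \<times> bool) monoid" where
  "dihedral_group n =
    \<lparr>carrier = {0..<int n} \<times> UNIV,
     mult = (\<lambda>(a, b) (c, d). ((if b then a - c else a + c) mod int n, b \<noteq> d)),
     one = (0, False)\<rparr>"

lemma card_dihedral_group: "card (carrier (dihedral_group n)) = 2 * n"
  by (simp add: dihedral_group_def card_cartesian_product)

lemma group_dihedral_group:
  assumes "n > 0"
  shows "group (dihedral_group n)"
proof (rule groupI, goal_cases)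
  case (5 x)
  obtain a b where x: "x = (a, b)" by (cases x)
  show ?case
    by (rule bexI[of _ "if b then (a, True) else ((- a) mod int n, False)"])
       (use 5 assms in \<open>auto simp: x dihedral_group_def mod_simps\<close>)
qed (use assms in \<open>auto simp: dihedral_group_def mod_simps algebra_simps\<close>)

definition linear_rep :: "('g, 'z) monoid_scheme \<Rightarrow> ('g \<Rightarrow> 'k::field ^ 'n ^ 'n) \<Rightarrow> bool" where
  "linear_rep G \<rho> \<longleftrightarrow>
    \<rho> \<one>\<^bsub>G\<^esub> = mat 1 \<and>
    (\<forall>g \<in> carrier G. \<forall>h \<in> carrier G. \<rho> (g \<otimes>\<^bsub>G\<^esub> h) = \<rho> g ** \<rho> h)"

definition irreducible_rep :: "('g, 'z) monoid_scheme \<Rightarrow> ('g \<Rightarrow> 'k::field ^ 'n ^ 'n) \<Rightarrow> bool" where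
  "irreducible_rep G \<rho> \<longleftrightarrow>
    linear_rep G \<rho> \<and>
    (\<forall>W. vec.subspace W \<and> (\<forall>g \<in> carrier G. (*v) (\<rho> g) ` W \<subseteq> W) \<longrightarrow> W = {0} \<or> W = UNIV)"

definition isomorphic_reps ::
    "('g, 'z) monoid_scheme \<Rightarrow> ('g \<Rightarrow> 'k::field ^ 'n ^ 'n) \<Rightarrow> ('g \<Rightarrow> 'k ^ 'n ^ 'n) \<Rightarrow> bool" where
  "isomorphic_reps G \<rho> \<sigma> \<longleftrightarrow>
    (\<exists>P. invertible P \<and> (\<forall>g \<in> carrier G. P ** \<rho> g = \<sigma> g ** P))"

definition trivial_rep :: "'g \<Rightarrow> 'k::field ^ 1 ^ 1" where
  "trivial_rep g = mat 1"

text \<open>Coordinates on a direct sum are indexed by the sum type of the two index types.\<close>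

definition direct_sum_rep ::
    "('g \<Rightarrow> 'k::field ^ 'n ^ 'n) \<Rightarrow> ('g \<Rightarrow> 'k ^ 'm ^ 'm) \<Rightarrow> 'g \<Rightarrow> 'k ^ ('n + 'm) ^ ('n + 'm)"
    (infixr \<open>\<oplus>\<^sub>r\<close> 65) where
  "(\<rho> \<oplus>\<^sub>r \<sigma>) g = (\<chi> i j. case (i, j) of
      (Inl a, Inl b) \<Rightarrow> \<rho> g $ a $ b
    | (Inr a, Inr b) \<Rightarrow> \<sigma> g $ a $ b
    | _ \<Rightarrow> 0)"

type_synonym ('k, 'n) mvpoly = "('n \<Rightarrow>\<^sub>0 nat) \<Rightarrow>\<^sub>0 'k"

definition eval_mvpoly :: "('k::field, 'n::finite) mvpoly \<Rightarrow> 'k ^ 'n \<Rightarrow> 'k" where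
  "eval_mvpoly F x = (\<Sum>m \<in> Poly_Mapping.keys F.
      Poly_Mapping.lookup F m * (\<Prod>i \<in> UNIV. x $ i ^ Poly_Mapping.lookup m i))"

definition homogeneous :: "nat \<Rightarrow> ('k::field, 'n::finite) mvpoly \<Rightarrow> bool" where
  "homogeneous d F \<longleftrightarrow>
    (\<forall>m \<in> Poly_Mapping.keys F. (\<Sum>i \<in> UNIV. Poly_Mapping.lookup m i) = d)"

definition partial_mvpoly :: "'n \<Rightarrow> ('k::field, 'n::finite) mvpoly \<Rightarrow> ('k, 'n) mvpoly" where
  "partial_mvpoly i F = (\<Sum>m \<in> Poly_Mapping.keys F.
      Poly_Mapping.single (m - Poly_Mapping.single i 1)
        (of_nat (Poly_Mapping.lookup m i) * Poly_Mapping.lookup F m))"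

text \<open>\<open>\<P>(k\<^sup>n)\<close> is the set of lines through the origin, so a point is a one-dimensional subspace.\<close>

definition proj_space :: "('k::field ^ 'n) set set" where
  "proj_space = {L. vec.subspace L \<and> vec.dim L = 1}"

definition proj_action :: "'k::field ^ 'n ^ 'n \<Rightarrow> ('k ^ 'n) set \<Rightarrow> ('k ^ 'n) set" where
  "proj_action A L = (*v) A ` L"

definition proj_zero_set :: "('k::field, 'n::finite) mvpoly \<Rightarrow> ('k ^ 'n) set set" where
  "proj_zero_set F = {L \<in> proj_space. \<forall>x \<in> L. eval_mvpoly F x = 0}"

definition zariski :: "('k::field ^ 'n) set topology" where
  "zariski = topology_generated_by {proj_space - proj_zero_set F | F. \<exists>d. homogeneous d F}"

lemma topspace_zariski: "topspace zariski = proj_space"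
proof -
  have "homogeneous 0 1" "proj_zero_set 1 = {}"
    by (auto simp: homogeneous_def proj_zero_set_def eval_mvpoly_def proj_space_def
        dest: vec.subspace_0)
  then show ?thesis
    unfolding zariski_def topology_generated_by_topspace by blast
qed

definition regular_map_on ::
    "('k::field ^ 'n) set set \<Rightarrow> (('k ^ 'n) set \<Rightarrow> ('k ^ 'm) set) \<Rightarrow> bool" where
  "regular_map_on U f \<longleftrightarrow>
    (\<forall>p \<in> U. \<exists>N d. \<exists>F :: 'm \<Rightarrow> ('k, 'n) mvpoly.
      openin (subtopology zariski U) N \<and> p \<in> N \<and> (\<forall>j. homogeneous d (F j)) \<and>
      (\<forall>q \<in> N. \<forall>x \<in> q - {0}.
        (\<chi> j. eval_mvpoly (F j) x) \<noteq> 0 \<and> f q = vec.span {\<chi> j. eval_mvpoly (F j) x}))"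

definition dense_open_in :: "('k::field ^ 'n) set set \<Rightarrow> ('k ^ 'n) set set \<Rightarrow> bool" where
  "dense_open_in X U \<longleftrightarrow>
    openin (subtopology zariski X) U \<and> subtopology zariski X closure_of U = X"

text \<open>Smoothness is the Jacobian criterion for the scheme \<open>F = 0\<close>; it excludes in particular the
  case where \<open>F\<close> is the square of a linear form.\<close>

definition smooth_quadric :: "('k::field ^ 'n) set set \<Rightarrow> bool" where
  "smooth_quadric X \<longleftrightarrow>
    (\<exists>F. F \<noteq> 0 \<and> homogeneous 2 F \<and> X = proj_zero_set F \<and>
      (\<forall>x. x \<noteq> 0 \<and> eval_mvpoly F x = 0 \<longrightarrow> (\<exists>i. eval_mvpoly (partial_mvpoly i F) x \<noteq> 0)))"

definition invariant_under ::
    "('g, 'z) monoid_scheme \<Rightarrow> ('g \<Rightarrow> 'k::field ^ 'n ^ 'n) \<Rightarrow> ('k ^ 'n) set set \<Rightarrow> bool" where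
  "invariant_under G \<rho> X \<longleftrightarrow> (\<forall>g \<in> carrier G. proj_action (\<rho> g) ` X = X)"

text \<open>A birational map is an isomorphism between dense open subsets. These need not be
  \<open>G\<close>-stable, so equivariance is required at the points \<open>p\<close> for which both \<open>p\<close> and \<open>g p\<close> lie in
  the domain.\<close>

definition equivariantly_birational ::
    "('g, 'z) monoid_scheme \<Rightarrow> ('g \<Rightarrow> 'k::field ^ 'n ^ 'n) \<Rightarrow> ('k ^ 'n) set set \<Rightarrow>
      ('g \<Rightarrow> 'k ^ 'm ^ 'm) \<Rightarrow> ('k ^ 'm) set set \<Rightarrow> bool" where
  "equivariantly_birational G \<rho> X \<tau> Y \<longleftrightarrow>
    (\<exists>U V f. dense_open_in X U \<and> dense_open_in Y V \<and> bij_betw f U V \<and>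
      regular_map_on U f \<and> regular_map_on V (inv_into U f) \<and>
      (\<forall>g \<in> carrier G. \<forall>p \<in> U. proj_action (\<rho> g) p \<in> U \<longrightarrow>
        f (proj_action (\<rho> g) p) = proj_action (\<tau> g) (f p)))"

definition linearizable ::
    "('g, 'z) monoid_scheme \<Rightarrow> ('g \<Rightarrow> 'k::field ^ 'n ^ 'n) \<Rightarrow> ('k ^ 'n) set set \<Rightarrow> bool" where
  "linearizable G \<rho> X \<longleftrightarrow>
    (\<exists>\<tau> :: 'g \<Rightarrow> 'k ^ 4 ^ 4. linear_rep G \<tau> \<and> equivariantly_birational G \<rho> X \<tau> proj_space)"

end

theory Submission
  imports Defs
begin

text \<open>In eigencoordinates of the rotation, an invariant smooth quadric is
  \<open>x\<^sup>2 = y\<^sub>1 y\<^sub>2 + z\<^sub>1 z\<^sub>2\<close>, where the weights of \<open>y\<^sub>1, y\<^sub>2, z\<^sub>1, z\<^sub>2\<close> are \<open>1, -1, 2, -2\<close> and the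
  reflection exchanges the two members of each pair: the form is semi-invariant, the character is
  trivial on rotations, and no other monomials have weight zero. Since the weight of \<open>z\<^sub>1\<close> is
  twice that of \<open>y\<^sub>1\<close>, the quadric surface bundle \<open>[y\<^sub>1 : y\<^sub>2]\<close> has the equivariant section
  \<open>(y\<^sub>1 y\<^sub>2, 0, 0, y\<^sub>1\<^sup>2, y\<^sub>2\<^sup>2)\<close>. Projecting its fibres from this section gives an equivariant
  birational map onto \<open>\<P>(V\<^sub>2 \<oplus> W)\<close>, where \<open>W\<close> is the permutation representation of the group
  modulo rotations; both the map and its inverse are explicit.\<close>

section \<open>Forms\<close>


text \<open>The only fixed point of the group on the ambient space is the line of the trivial
  summand, and it lies off every smooth invariant quadric. Invariance is assumed of the set of
  points only. The form is semi-invariant because a quadratic form vanishing on the zeros of one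
  with an isotropic vector outside its radical is a multiple of that one
  (\<open>quadratic_form_dominated\<close>). The formula for the map arises as follows. On the fibre
  over [a : b] write (y1, y2) = t (a, b) and use the coordinates (x, t, z1, z2). The section is (a
  b, 0, a^2, b^2), and for nonzero a and b the linear forms vanishing there are spanned by t, a b x
  - b^2 z1 and a b x - a^2 z2. The last two are fixed by rotations and exchanged by the reflection,
  hence the summand W. The first, multiplied by (a, b), gives V_2.\<close>

definition monomial_value :: "('n::finite \<Rightarrow>\<^sub>0 nat) \<Rightarrow> 'k::field ^ 'n \<Rightarrow> 'k" where
  "monomial_value m x = (\<Prod>i \<in> UNIV. x $ i ^ Poly_Mapping.lookup m i)"

lemma monomial_value_add: "monomial_value (m + n) x = monomial_value m x * monomial_value n x"
  by (simp add: monomial_value_def lookup_add power_add prod.distrib)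

lemma monomial_value_zero [simp]: "monomial_value 0 x = 1"
  by (simp add: monomial_value_def)

lemma monomial_value_single [simp]: "monomial_value (Poly_Mapping.single i (Suc 0)) x = x $ i"
  by (simp add: monomial_value_def lookup_single when_def power_0 if_distrib cong: if_cong)

lemma eval_mvpoly_superset:
  assumes "finite A" "Poly_Mapping.keys F \<subseteq> A"
  shows "eval_mvpoly F x = (\<Sum>m\<in>A. Poly_Mapping.lookup F m * monomial_value m x)"
  unfolding eval_mvpoly_def monomial_value_def
  by (rule sum.mono_neutral_left) (use assms in \<open>auto simp: in_keys_iff\<close>)

lemma eval_mvpoly_eq:
  "eval_mvpoly F x = (\<Sum>m\<in>Poly_Mapping.keys F. Poly_Mapping.lookup F m * monomial_value m x)"
  by (rule eval_mvpoly_superset) auto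

lemma eval_mvpoly_zero [simp]: "eval_mvpoly 0 x = 0"
  by (simp add: eval_mvpoly_eq)

lemma eval_mvpoly_single [simp]: "eval_mvpoly (Poly_Mapping.single m c) x = c * monomial_value m x"
  by (subst eval_mvpoly_superset[of "{m}"]) auto

lemma eval_mvpoly_add: "eval_mvpoly (F + G) x = eval_mvpoly F x + eval_mvpoly G x"
proof -
  let ?A = "Poly_Mapping.keys F \<union> Poly_Mapping.keys G"
  have "Poly_Mapping.keys (F + G) \<subseteq> ?A"
    by (rule Poly_Mapping.keys_add)
  then show ?thesis
    by (simp add: eval_mvpoly_superset[of ?A] lookup_add algebra_simps sum.distrib)
qed

lemma eval_mvpoly_sum: "eval_mvpoly (\<Sum>i\<in>I. F i) x = (\<Sum>i\<in>I. eval_mvpoly (F i) x)"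
  by (induction I rule: infinite_finite_induct) (simp_all add: eval_mvpoly_add)

text \<open>Forms are handled as functions, so that identities between them reduce to pointwise
  arithmetic; a polynomial is produced only where a definition asks for one.\<close>

definition form :: "nat \<Rightarrow> ('k::field ^ 'n::finite \<Rightarrow> 'k) \<Rightarrow> bool" where
  "form d f \<longleftrightarrow> (\<exists>F. homogeneous d F \<and> eval_mvpoly F = f)"

lemma form_eval_mvpoly: "homogeneous d F \<Longrightarrow> form d (eval_mvpoly F)"
  by (auto simp: form_def)

lemma homogeneous_single:
  "(\<Sum>i\<in>UNIV. Poly_Mapping.lookup m i) = d \<Longrightarrow> homogeneous d (Poly_Mapping.single m c)"
  by (auto simp: homogeneous_def)

lemma homogeneous_add: "homogeneous d F \<Longrightarrow> homogeneous d G \<Longrightarrow> homogeneous d (F + G)"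
  using Poly_Mapping.keys_add[of F G] by (fastforce simp: homogeneous_def)

lemma form_monomial_value:
  "(\<Sum>i\<in>UNIV. Poly_Mapping.lookup m i) = d \<Longrightarrow> form d (\<lambda>x. c * monomial_value m x)"
  unfolding form_def by (rule exI[of _ "Poly_Mapping.single m c"]) (auto intro: homogeneous_single)

lemma form_zero: "form d (\<lambda>x. 0)"
  unfolding form_def by (rule exI[of _ 0]) (auto simp: homogeneous_def)

lemma form_const: "form 0 (\<lambda>x. c)"
  using form_monomial_value[of 0 0 c] by simp

lemma form_coord: "form 1 (\<lambda>x. x $ i)"
proof -
  have "form 1 (\<lambda>x. 1 * monomial_value (Poly_Mapping.single i 1) x)"
    by (rule form_monomial_value) (simp add: lookup_single when_def)
  then show ?thesis
    by simp
qed

lemma form_add: "form d f \<Longrightarrow> form d g \<Longrightarrow> form d (\<lambda>x. f x + g x)"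
  unfolding form_def by (metis (no_types, lifting) ext eval_mvpoly_add homogeneous_add)

lemma form_sum: "(\<And>i. i \<in> I \<Longrightarrow> form d (f i)) \<Longrightarrow> form d (\<lambda>x. \<Sum>i\<in>I. f i x)"
  by (induction I rule: infinite_finite_induct) (auto intro: form_zero form_add)

lemma form_mult:
  assumes "form d f" "form e g"
  shows "form (d + e) (\<lambda>x. f x * g x)"
proof -
  obtain F G where F: "homogeneous d F" "eval_mvpoly F = f" and G: "homogeneous e G" "eval_mvpoly G = g"
    using assms by (auto simp: form_def)
  have "form (d + e) (\<lambda>x. \<Sum>m\<in>Poly_Mapping.keys F. \<Sum>n\<in>Poly_Mapping.keys G.
      (Poly_Mapping.lookup F m * Poly_Mapping.lookup G n) * monomial_value (m + n) x)"
    using F(1) G(1)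
    by (intro form_sum form_monomial_value) (auto simp: homogeneous_def lookup_add sum.distrib)
  also have "(\<lambda>x. \<Sum>m\<in>Poly_Mapping.keys F. \<Sum>n\<in>Poly_Mapping.keys G.
      (Poly_Mapping.lookup F m * Poly_Mapping.lookup G n) * monomial_value (m + n) x) = (\<lambda>x. f x * g x)"
    unfolding F(2)[symmetric] G(2)[symmetric]
    by (simp add: eval_mvpoly_eq sum_product monomial_value_add mult_ac)
  finally show ?thesis .
qed

lemma form_cmult: "form d f \<Longrightarrow> form d (\<lambda>x. c * f x)"
  using form_mult[OF form_const] by force

lemma form_diff: "form d f \<Longrightarrow> form d g \<Longrightarrow> form d (\<lambda>x. f x - g x)"
  using form_add[OF _ form_cmult[of d g "-1"]] by simp

lemma form_matrix: "form 1 (\<lambda>x. (A *v x) $ i)"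
  unfolding matrix_vector_mult_def vec_lambda_beta by (intro form_sum form_cmult form_coord)

lemma form_scale:
  assumes "form d f"
  shows "f (c *s x) = c ^ d * f x"
proof -
  obtain F where F: "homogeneous d F" "eval_mvpoly F = f"
    using assms by (auto simp: form_def)
  have "monomial_value m (c *s x) = c ^ d * monomial_value m x" if "m \<in> Poly_Mapping.keys F" for m
  proof -
    have "(\<Prod>i\<in>UNIV. c ^ Poly_Mapping.lookup m i) = c ^ d"
      using F(1) that by (simp flip: power_sum add: homogeneous_def)
    then show ?thesis
      by (simp add: monomial_value_def power_mult_distrib prod.distrib)
  qed
  then show ?thesis
    unfolding F(2)[symmetric] by (simp add: eval_mvpoly_eq sum_distrib_left mult_ac)
qed

text \<open>A rational curve lifted to the affine cone; the lift may pass through 0, where it names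
  no point.\<close>

definition poly_curve :: "('k::field \<Rightarrow> 'k ^ 'n) \<Rightarrow> bool" where
  "poly_curve \<gamma> \<longleftrightarrow> (\<forall>i. \<exists>p. \<forall>t. \<gamma> t $ i = poly p t)"

lemma form_poly_curve:
  assumes "form d f" "poly_curve \<gamma>"
  obtains p where "\<And>t. f (\<gamma> t) = poly p t"
proof -
  obtain F where F: "homogeneous d F" "eval_mvpoly F = f"
    using assms(1) by (auto simp: form_def)
  obtain P where P: "\<And>i t. \<gamma> t $ i = poly (P i) t"
    using assms(2) unfolding poly_curve_def by metis
  have "f (\<gamma> t) = poly (\<Sum>m\<in>Poly_Mapping.keys F.
      [:Poly_Mapping.lookup F m:] * (\<Prod>i\<in>UNIV. P i ^ Poly_Mapping.lookup m i)) t" for t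
    unfolding F(2)[symmetric] by (simp add: eval_mvpoly_def P poly_sum poly_prod)
  then show ?thesis
    by (rule that)
qed

section \<open>The Zariski topology\<close>

lemma proj_space_iff: "L \<in> proj_space \<longleftrightarrow> (\<exists>x. x \<noteq> 0 \<and> L = vec.span {x})"
proof
  assume "L \<in> proj_space"
  then have L: "vec.subspace L" "vec.dim L = 1"
    by (auto simp: proj_space_def)
  obtain B where B: "B \<subseteq> L" "vec.independent B" "L \<subseteq> vec.span B" "card B = vec.dim L"
    using vec.basis_exists by blast
  then obtain x where x: "B = {x}"
    using L(2) by (metis card_1_singletonE)
  have "L = vec.span {x}"
    using B L(1) by (metis x vec.span_minimal subset_antisym)
  moreover have "x \<noteq> 0"
    using B(2) x vec.dependent_zero by blast
  ultimately show "\<exists>x. x \<noteq> 0 \<and> L = vec.span {x}" by blast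
next
  assume "\<exists>x. x \<noteq> 0 \<and> L = vec.span {x}"
  then obtain x where x: "x \<noteq> 0" "L = vec.span {x}" by blast
  then have "vec.dim L = 1"
    by (simp add: vec.dim_eq_card_independent)
  then show "L \<in> proj_space"
    by (simp add: proj_space_def x(2))
qed

lemma span_eq_of_mem:
  assumes "y \<in> vec.span {x}" "y \<noteq> 0"
  shows "vec.span {y} = vec.span {x}"
proof -
  obtain c where c: "y = c *s x" "c \<noteq> 0"
    using assms by (auto simp: vec.span_singleton)
  then have "x = (1 / c) *s y"
    by (simp add: vector_smult_assoc)
  then have "x \<in> vec.span {y}"
    by (metis insertI1 vec.span_base vec.span_scale)
  then show ?thesis
    using assms(1) by (simp add: vec.span_eq)
qed

lemma proj_space_mem: "L \<in> proj_space \<Longrightarrow> x \<in> L \<Longrightarrow> x \<noteq> 0 \<Longrightarrow> L = vec.span {x}"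
  unfolding proj_space_iff using span_eq_of_mem by blast

text \<open>The distinguished open set D(f). For a form, any single nonzero vector of
  \<open>L\<close> decides membership.\<close>

definition nonvanishing :: "('k::field ^ 'n \<Rightarrow> 'k) \<Rightarrow> ('k ^ 'n) set set" where
  "nonvanishing f = {L \<in> proj_space. \<exists>x \<in> L. f x \<noteq> 0}"

lemma span_in_nonvanishing:
  assumes "form d f" "x \<noteq> 0"
  shows "vec.span {x} \<in> nonvanishing f \<longleftrightarrow> f x \<noteq> 0"
  using assms vec.span_base[of x "{x}"]
  by (auto simp: nonvanishing_def proj_space_iff vec.span_singleton form_scale[OF assms(1)])

lemma nonvanishing_times:
  assumes "form d f" "form e g"
  shows "nonvanishing f \<inter> nonvanishing g = nonvanishing (\<lambda>x. f x * g x)"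
proof -
  have "L \<in> nonvanishing f \<inter> nonvanishing g \<longleftrightarrow> L \<in> nonvanishing (\<lambda>x. f x * g x)"
    if L: "L \<in> proj_space" for L
    using L unfolding proj_space_iff
    by (auto simp: span_in_nonvanishing[OF assms(1)] span_in_nonvanishing[OF assms(2)]
        span_in_nonvanishing[OF form_mult[OF assms]])
  then show ?thesis
    by (auto simp: nonvanishing_def)
qed

lemma openin_zariski_nonvanishing:
  assumes "form d f"
  shows "openin zariski (nonvanishing f)"
proof -
  obtain F where F: "homogeneous d F" "eval_mvpoly F = f"
    using assms by (auto simp: form_def)
  have "nonvanishing f = proj_space - proj_zero_set F"
    by (auto simp: nonvanishing_def proj_zero_set_def F)
  then show ?thesis
    unfolding zariski_def using F(1)
    by (auto intro!: topology_generated_by_Basis)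
qed

text \<open>The generators form a basis and not merely a subbasis, because D(f) and D(g) meet in D(f
  g).\<close>

lemma zariski_basis:
  assumes "openin zariski T" "L \<in> T"
  obtains d f where "form d f" "L \<in> nonvanishing f" "nonvanishing f \<subseteq> T"
proof -
  have "generate_topology_on {proj_space - proj_zero_set F | F. \<exists>d. homogeneous d F} T"
    using assms(1) unfolding zariski_def by (simp add: openin_topology_generated_by)
  then have "L \<in> T \<longrightarrow> (\<exists>d f. form d f \<and> L \<in> nonvanishing f \<and> nonvanishing f \<subseteq> T)"
  proof induction
    case (Int a b)
    show ?case
    proof
      assume "L \<in> a \<inter> b"
      then obtain d f e g where "form d f" "L \<in> nonvanishing f" "nonvanishing f \<subseteq> a"
        "form e g" "L \<in> nonvanishing g" "nonvanishing g \<subseteq> b"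
        using Int.IH by blast
      then show "\<exists>d f. form d f \<and> L \<in> nonvanishing f \<and> nonvanishing f \<subseteq> a \<inter> b"
        using nonvanishing_times[of d f e g] form_mult[of d f e g] by blast
    qed
  next
    case (Basis s)
    then obtain F d where F: "s = proj_space - proj_zero_set F" "homogeneous d F" by blast
    have "nonvanishing (eval_mvpoly F) = s"
      by (auto simp: nonvanishing_def proj_zero_set_def F)
    then show ?case
      using form_eval_mvpoly[OF F(2)] by blast
  qed blast+
  then show ?thesis
    using assms(2) that by blast
qed

text \<open>A form that does not vanish at \<open>p = [\<gamma> 0]\<close> and the form \<open>h\<close> restrict to nonzero polynomials
  on the rational curve \<open>\<gamma>\<close>, hence have a common nonzero value on it.\<close>

lemma dense_open_in_nonvanishing:
  fixes X :: "('k::field_char_0 ^ 'n) set set"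
  assumes X: "X \<subseteq> proj_space" and h: "form d h"
    and curve: "\<And>L. L \<in> X \<Longrightarrow> \<exists>\<gamma>. poly_curve \<gamma> \<and> \<gamma> 0 \<noteq> 0 \<and> vec.span {\<gamma> 0} = L \<and>
        h (\<gamma> 1) \<noteq> 0 \<and> (\<forall>t. \<gamma> t \<noteq> 0 \<longrightarrow> vec.span {\<gamma> t} \<in> X)"
  shows "dense_open_in X (X \<inter> nonvanishing h)"
proof -
  have "X \<subseteq> subtopology zariski X closure_of (X \<inter> nonvanishing h)"
  proof
    fix L assume L: "L \<in> X"
    obtain \<gamma> where \<gamma>: "poly_curve \<gamma>" "\<gamma> 0 \<noteq> 0" "vec.span {\<gamma> 0} = L" "h (\<gamma> 1) \<noteq> 0"
      "\<And>t. \<gamma> t \<noteq> 0 \<Longrightarrow> vec.span {\<gamma> t} \<in> X"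
      using curve[OF L] by blast
    have "\<exists>M. M \<in> X \<inter> nonvanishing h \<and> M \<in> T" if T: "L \<in> T" "openin (subtopology zariski X) T" for T
    proof -
      obtain T' where T': "openin zariski T'" "T = T' \<inter> X"
        using T(2) by (auto simp: openin_subtopology)
      obtain e f where f: "form e f" "L \<in> nonvanishing f" "nonvanishing f \<subseteq> T'"
        using zariski_basis[OF T'(1)] T(1) T'(2) by blast
      obtain p where p: "\<And>t. f (\<gamma> t) = poly p t"
        using form_poly_curve[OF f(1) \<gamma>(1)] by blast
      obtain q where q: "\<And>t. h (\<gamma> t) = poly q t"
        using form_poly_curve[OF h \<gamma>(1)] by blast
      \<comment> \<open>A third polynomial keeps the parameter away from zeros of the lifted curve:
        this coordinate is nonzero at 0, hence is a nonzero polynomial.\<close>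
      obtain i where "\<gamma> 0 $ i \<noteq> 0"
        using \<gamma>(2) by (metis vec_eq_iff zero_index)
      then obtain u where u: "\<And>t. \<gamma> t $ i = poly u t" "poly u 0 \<noteq> 0"
        using \<gamma>(1) unfolding poly_curve_def by metis
      have "f (\<gamma> 0) \<noteq> 0"
        using f(1,2) \<gamma>(2,3) span_in_nonvanishing by blast
      then have "p \<noteq> 0" "q \<noteq> 0" "u \<noteq> 0"
        using p[of 0] q[of 1] u(2) \<gamma>(4) by auto
      then have "p * q * u \<noteq> 0" by simp
      then obtain t where "poly (p * q * u) t \<noteq> 0"
        using poly_all_0_iff_0 by blast
      then have t: "f (\<gamma> t) \<noteq> 0" "h (\<gamma> t) \<noteq> 0" "\<gamma> t \<noteq> 0"
        using u(1)[of t] by (auto simp: p q)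
      then have "vec.span {\<gamma> t} \<in> X \<inter> nonvanishing h" "vec.span {\<gamma> t} \<in> T'"
        using \<gamma>(5) span_in_nonvanishing[OF h] span_in_nonvanishing[OF f(1)] f(3) by blast+
      then show ?thesis
        using T'(2) by blast
    qed
    then show "L \<in> subtopology zariski X closure_of (X \<inter> nonvanishing h)"
      using L X by (auto simp: in_closure_of topspace_zariski)
  qed
  moreover have "subtopology zariski X closure_of (X \<inter> nonvanishing h) \<subseteq> X"
    using closure_of_subset_topspace by fastforce
  ultimately show ?thesis
    unfolding dense_open_in_def
    using openin_zariski_nonvanishing[OF h] by (auto simp: openin_subtopology)
qed


section \<open>Quadratic forms\<close>

text \<open>The polar form is kept without the factor 1/2, so that its values at basis vectors are
  the partial derivatives of \<open>q\<close>.\<close>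

locale quadratic_form =
  fixes q :: "'k::field ^ 'n \<Rightarrow> 'k" and B :: "'k ^ 'n \<Rightarrow> 'k ^ 'n \<Rightarrow> 'k"
  assumes add: "q (x + y) = q x + q y + B x y"
    and scale: "q (c *s x) = c ^ 2 * q x"
    and polar_add_left: "B (x + x') y = B x y + B x' y"
    and polar_scale_left: "B (c *s x) y = c * B x y"
begin

lemma polar_commute: "B x y = B y x"
  using add[of x y] add[of y x] by (simp add: add.commute)

lemma polar_add_right: "B x (y + y') = B x y + B x y'"
  by (metis polar_commute polar_add_left)

lemma polar_scale_right: "B x (c *s y) = c * B x y"
  by (metis polar_commute polar_scale_left)

lemma polar_self: "B x x = 2 * q x"
proof -
  have "x + x = 2 *s x"
    by (simp add: vec_eq_iff)
  then have "q (x + x) = 4 * q x"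
    by (simp only: scale) simp
  then show ?thesis
    unfolding add by algebra
qed

lemma zero [simp]: "q 0 = 0"
  using scale[of 0 0] by simp

lemmas polar_simps = polar_add_left polar_add_right polar_scale_left polar_scale_right

lemma matrix: "quadratic_form (\<lambda>x. q (A *v x)) (\<lambda>x y. B (A *v x) (A *v y))"
  by unfold_locales
    (simp_all add: matrix_vector_right_distrib vector_scalar_commute add scale polar_simps)

end

lemma monomial_split:
  assumes "(\<Sum>i\<in>UNIV. Poly_Mapping.lookup m i) = Suc d"
  obtains a m' where "m = Poly_Mapping.single (a::'n::finite) 1 + m'"
    "(\<Sum>i\<in>UNIV. Poly_Mapping.lookup m' i) = d"
proof -
  obtain a where a: "Poly_Mapping.lookup m a > 0"
    using assms by (metis finite sum_eq_0_iff Zero_not_Suc gr0I)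
  define m' where "m' = m - Poly_Mapping.single a 1"
  have m: "m = Poly_Mapping.single a 1 + m'"
    by (rule poly_mapping_eqI)
      (use a in \<open>auto simp: m'_def lookup_add lookup_minus lookup_single when_def\<close>)
  have "(\<Sum>i\<in>UNIV. Poly_Mapping.lookup m' i) = d"
    using assms unfolding m by (simp add: lookup_add sum.distrib lookup_single when_def)
  with m show ?thesis
    by (rule that)
qed

lemma quadratic_monomial:
  assumes "(\<Sum>i\<in>UNIV. Poly_Mapping.lookup m i) = (2::nat)"
  shows "\<exists>a b. m = Poly_Mapping.single (a::'n::finite) 1 + Poly_Mapping.single b 1"
proof -
  obtain a m' where m: "m = Poly_Mapping.single a 1 + m'" "(\<Sum>i\<in>UNIV. Poly_Mapping.lookup m' i) = 1"
    using monomial_split[of m 1] assms by auto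
  obtain b m'' where m': "m' = Poly_Mapping.single b 1 + m''" "(\<Sum>i\<in>UNIV. Poly_Mapping.lookup m'' i) = 0"
    using monomial_split[of m' 0] m(2) by auto
  have "m'' = 0"
    by (rule poly_mapping_eqI) (use m'(2) in simp)
  then show ?thesis
    using m m' by auto
qed

text \<open>The second conclusion translates the Jacobian criterion: smoothness says that no nonzero
  isotropic vector is orthogonal to the whole space.\<close>

lemma quadratic_form_eval_mvpoly:
  fixes F :: "('k::field, 'n::finite) mvpoly"
  assumes "homogeneous 2 F"
  obtains B where "quadratic_form (eval_mvpoly F) B"
    "\<And>x i. eval_mvpoly (partial_mvpoly i F) x = B x (axis i 1)"
proof -
  let ?c = "Poly_Mapping.lookup F"
  obtain a b where ab: "\<And>m. m \<in> Poly_Mapping.keys F \<Longrightarrow>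
      m = Poly_Mapping.single (a m) 1 + Poly_Mapping.single (b m) 1"
    using assms quadratic_monomial unfolding homogeneous_def by metis
  have val: "monomial_value m x = x $ a m * x $ b m" if "m \<in> Poly_Mapping.keys F" for m x
    by (metis One_nat_def ab[OF that] monomial_value_add monomial_value_single)
  have eval: "eval_mvpoly F x = (\<Sum>m\<in>Poly_Mapping.keys F. ?c m * (x $ a m * x $ b m))" for x
    unfolding eval_mvpoly_eq by (simp add: val)
  define B where "B x y = (\<Sum>m\<in>Poly_Mapping.keys F. ?c m * (x $ a m * y $ b m + y $ a m * x $ b m))" for x y
  have "quadratic_form (eval_mvpoly F) B"
    by unfold_locales
      (simp_all add: eval B_def sum.distrib sum_distrib_left algebra_simps power2_eq_square)
  moreover have "eval_mvpoly (partial_mvpoly i F) x = B x (axis i 1)" for x i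
    unfolding partial_mvpoly_def eval_mvpoly_sum B_def
  proof (rule sum.cong)
    fix m assume m: "m \<in> Poly_Mapping.keys F"
    let ?d = "\<lambda>j. if j = i then 1 else 0 :: 'k"
    \<comment> \<open>If \<open>i\<close> does not occur in \<open>m\<close>, the truncated
      subtraction leaves \<open>m\<close> unchanged, but the coefficient is 0. If
      \<open>a m = b m = i\<close>, both terms on the right count and give the derivative of a
      square.\<close>
    have "of_nat (Poly_Mapping.lookup m i) * monomial_value (m - Poly_Mapping.single i 1) x
        = ?d (b m) * x $ a m + ?d (a m) * x $ b m"
      by (subst (1 2) ab[OF m]) (auto simp: lookup_add lookup_single when_def)
    then show "eval_mvpoly (Poly_Mapping.single (m - Poly_Mapping.single i 1)
          (of_nat (Poly_Mapping.lookup m i) * ?c m)) x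
        = ?c m * (x $ a m * axis i 1 $ b m + axis i 1 $ a m * x $ b m)"
      by (simp add: axis_def algebra_simps)
  qed simp
  ultimately show ?thesis
    by (rule that)
qed

text \<open>The second intersection of the quadric with the line joining an isotropic \<open>p\<close> to \<open>v\<close>.\<close>

lemma (in quadratic_form) isotropic_residual:
  assumes "q p = 0"
  shows "q (q v *s p + (- B p v) *s v) = 0"
  unfolding add scale polar_simps using assms by algebra

text \<open>An elementary Nullstellensatz for quadrics: off the tangent hyperplane at
  \<open>p\<close>, residual points give the ratio of \<open>q'\<close> to \<open>q\<close> at
  \<open>v\<close> as \<open>B' p v / B p v\<close>. Completing \<open>p\<close> to a hyperbolic
  pair and splitting off its plane shows that the ratio is constant.\<close>

lemma quadratic_form_dominated:
  assumes "quadratic_form q B" "quadratic_form q' B'" and sub: "\<And>x. q x = 0 \<Longrightarrow> q' x = 0"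
    and p: "q p = 0" "B p v \<noteq> (0 :: 'k::field_char_0)"
  shows "\<exists>c. \<forall>x. q' x = c * q x"
proof -
  interpret q: quadratic_form q B by fact
  interpret q': quadratic_form q' B' by fact
  \<comment> \<open>The residual point of \<open>v\<close> on its line through \<open>p\<close> is a
    zero of \<open>q\<close>, so \<open>q'\<close> vanishes there too; one factor
    \<open>B p v\<close> cancels.\<close>
  have key: "B p v * q' v = q v * B' p v" if "q p = 0" "B p v \<noteq> 0" for p v
  proof -
    have "0 = q' (q v *s p + (- B p v) *s v)"
      using sub q.isotropic_residual[OF that(1)] by simp
    also have "\<dots> = B p v * (B p v * q' v - q v * B' p v)"
      unfolding q'.add q'.scale q'.polar_simps using sub[OF that(1)] by algebra
    finally show ?thesis
      using that(2) by simp
  qed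
  \<comment> \<open>The residual point, rescaled so that \<open>p\<close> and \<open>r\<close> form
    a hyperbolic pair.\<close>
  define r where "r = (- 1 / (B p v) ^ 2) *s (q v *s p + (- B p v) *s v)"
  have r: "q r = 0" "B p r = 1"
    unfolding r_def q.scale q.isotropic_residual[OF p(1)] q.polar_simps q.polar_self
    using p by (simp_all add: power2_eq_square)
  \<comment> \<open>Stated for every hyperbolic pair because it is applied twice, the second time
    with the two members exchanged.\<close>
  have orth: "q' w = B' p r * q w \<and> B' r w = 0"
    if "B p w = 0" "B r w = 0" "q p = 0" "q r = 0" "B p r = 1" for p r w
  proof -
    \<comment> \<open>This is \<open>key\<close> at \<open>b *s r + w\<close>, where
      \<open>B p\<close> takes the value \<open>b\<close>; hence \<open>b\<close> must be
      nonzero.\<close>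
    have eq: "b * (b * B' r w + q' w) = q w * (b * B' p r + B' p w)" if "b \<noteq> 0" for b
      using key[of p "b *s r + w"] that \<open>B p w = 0\<close> \<open>B r w = 0\<close> \<open>q p = 0\<close> \<open>q r = 0\<close> \<open>B p r = 1\<close> sub[of r]
      by (simp add: q.add q.scale q.polar_simps q'.add q'.scale q'.polar_simps algebra_simps
          q.polar_commute[of w r] q'.polar_commute[of w r])
    define A D E where "A = B' r w" "D = q' w - B' p r * q w" "E = q w * B' p w"
    \<comment> \<open>The polynomial A b^2 + D b - E vanishes at three nonzero values of b, so in
      characteristic 0 its coefficients vanish.\<close>
    have "A + D - E = 0" "A - D - E = 0" "4 * A + 2 * D - E = 0"
      using eq[of 1] eq[of "-1"] eq[of 2] by (simp_all add: A_D_E_def algebra_simps)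
    moreover have "2 * D = (A + D - E) - (A - D - E)"
      "6 * A = (A - D - E) + 2 * (4 * A + 2 * D - E) - 3 * (A + D - E)"
      by (simp_all add: algebra_simps)
    ultimately have "2 * D = 0" "6 * A = 0"
      by simp_all
    then show ?thesis
      by (simp add: A_D_E_def)
  qed
  have "q' x = B' p r * q x" for x
  proof -
    \<comment> \<open>The component of \<open>x\<close> orthogonal to the hyperbolic plane of
      \<open>p\<close> and \<open>r\<close>.\<close>
    define w where "w = x + (- B r x) *s p + (- B p x) *s r"
    have x: "x = (B r x *s p + B p x *s r) + w"
      by (simp add: w_def vec_eq_iff)
    have rp: "B r p = 1" "B p p = 0" "B r r = 0"
      using r p q.polar_commute[of r p] by (simp_all add: q.polar_self)
    have w: "B p w = 0" "B r w = 0"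
      unfolding w_def q.polar_simps using r p rp by simp_all
    have w': "q' w = B' p r * q w" "B' r w = 0" "B' p w = 0"
      using orth[of p w r] orth[of r w p] w p r rp by auto
    define s t where "s = B r x" "t = B p x"
    have "x = (s *s p + t *s r) + w"
      unfolding s_t_def by (rule x)
    moreover have "q (s *s p + t *s r + w) = s * t + q w"
      unfolding q.add q.scale q.polar_simps using p r w by simp
    moreover have "q' (s *s p + t *s r + w) = s * t * B' p r + q' w"
      unfolding q'.add q'.scale q'.polar_simps using sub[OF p(1)] sub[OF r(1)] w' by simp
    ultimately show ?thesis
      using w'(1) by (simp add: algebra_simps)
  qed
  then show ?thesis by blast
qed

section \<open>Coordinates on the five-dimensional space and invariant quadratic forms\<close>

definition mk5 :: "'k \<Rightarrow> 'k \<Rightarrow> 'k \<Rightarrow> 'k \<Rightarrow> 'k \<Rightarrow> 'k ^ (1 + 2 + 2)" where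
  "mk5 x y1 y2 z1 z2 = (\<chi> i. case i of Inl _ \<Rightarrow> x
    | Inr (Inl j) \<Rightarrow> if j = 1 then y1 else y2
    | Inr (Inr j) \<Rightarrow> if j = 1 then z1 else z2)"

lemma mk5_nth [simp]:
  "mk5 x y1 y2 z1 z2 $ Inl i = x"
  "mk5 x y1 y2 z1 z2 $ Inr (Inl 1) = y1" "mk5 x y1 y2 z1 z2 $ Inr (Inl 2) = y2"
  "mk5 x y1 y2 z1 z2 $ Inr (Inr 1) = z1" "mk5 x y1 y2 z1 z2 $ Inr (Inr 2) = z2"
  by (simp_all add: mk5_def)

lemma forall_five: "(\<forall>i :: 1 + 2 + 2. P i) \<longleftrightarrow>
    P (Inl 1) \<and> P (Inr (Inl 1)) \<and> P (Inr (Inl 2)) \<and> P (Inr (Inr 1)) \<and> P (Inr (Inr 2))"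
  by (simp only: split_sum_all forall_1 forall_2 conj_assoc)

lemma vec5_eq_iff: "(v :: 'k ^ (1 + 2 + 2)) = w \<longleftrightarrow>
    v $ Inl 1 = w $ Inl 1 \<and> v $ Inr (Inl 1) = w $ Inr (Inl 1) \<and> v $ Inr (Inl 2) = w $ Inr (Inl 2) \<and>
    v $ Inr (Inr 1) = w $ Inr (Inr 1) \<and> v $ Inr (Inr 2) = w $ Inr (Inr 2)"
  by (simp add: vec_eq_iff forall_five)

lemma mk5_exhaust:
  obtains x y1 y2 z1 z2 where "v = mk5 x y1 y2 z1 z2"
  by (rule that[of "v $ Inl 1" "v $ Inr (Inl 1)" "v $ Inr (Inl 2)" "v $ Inr (Inr 1)" "v $ Inr (Inr 2)"])
    (simp add: vec5_eq_iff)

lemma mk5_inject [simp]: "mk5 x y1 y2 z1 z2 = mk5 x' y1' y2' z1' z2' \<longleftrightarrow>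
    x = x' \<and> y1 = y1' \<and> y2 = y2' \<and> z1 = z1' \<and> z2 = z2'"
  by (simp add: vec5_eq_iff)

lemma mk5_zero_iff [simp]: "mk5 x y1 y2 z1 z2 = 0 \<longleftrightarrow> x = 0 \<and> y1 = 0 \<and> y2 = 0 \<and> z1 = 0 \<and> z2 = 0"
  by (simp add: vec5_eq_iff)

lemma mk5_add [simp]: "mk5 x y1 y2 z1 z2 + mk5 x' y1' y2' z1' z2' =
    mk5 (x + x') (y1 + y1') (y2 + y2') (z1 + z1') (z2 + z2')"
  by (simp add: vec5_eq_iff)

lemma mk5_scale [simp]: "c *s mk5 x y1 y2 z1 z2 = mk5 (c * x) (c * y1) (c * y2) (c * z1) (c * z2)"
  by (simp add: vec5_eq_iff)

text \<open>A two-dimensional coordinate subspace suffices: on the line \<open>e + t *s f\<close>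
  the form is a quadratic polynomial in \<open>t\<close>, which has a root.\<close>

lemma exists_isotropic:
  fixes q :: "'k::alg_closed_field ^ (1 + 2 + 2) \<Rightarrow> 'k"
  assumes "quadratic_form q B"
  obtains p where "p \<noteq> 0" "q p = 0"
proof -
  interpret quadratic_form q B by fact
  define e f where "e = mk5 1 0 0 0 (0::'k)" "f = mk5 0 1 0 0 (0::'k)"
  show ?thesis
  proof (cases "q f = 0")
    case True
    then show ?thesis
      by (intro that[of f]) (simp_all add: e_f_def)
  next
    case False
    then have "degree [:q e, B e f, q f:] > 0" by simp
    then obtain t where "poly [:q e, B e f, q f:] t = 0"
      using alg_closed_imp_poly_has_root by blast
    then have "q (e + t *s f) = 0"
      by (simp add: add scale polar_simps power2_eq_square algebra_simps)
    then show ?thesis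
      by (intro that[of "e + t *s f"]) (simp_all add: e_f_def)
  qed
qed

text \<open>Let \<open>c\<close> and \<open>d\<close> be the factors by which \<open>R\<close> and
  \<open>S\<close> multiply \<open>q\<close>. The relations R^5 = 1, (S R)^2 = 1 and S^2 = 1 give
  c^5 = 1 and c^2 = 1, so c = 1. Invariance under \<open>R\<close> then kills \<open>B\<close> on
  eigenvectors unless their eigenvalues multiply to 1, which leaves three monomials.\<close>

lemma invariant_quadratic_form:
  fixes q :: "'k::{alg_closed_field, field_char_0} ^ (1 + 2 + 2) \<Rightarrow> 'k"
  assumes "quadratic_form q B"
    and nonsing: "\<And>x. q x = 0 \<Longrightarrow> x \<noteq> 0 \<Longrightarrow> \<exists>y. B x y \<noteq> 0"
    and l: "l ^ 5 = 1" "l \<noteq> 1"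
    and R: "\<And>x y1 y2 z1 z2. R *v mk5 x y1 y2 z1 z2 = mk5 x (l * y1) (y2 / l) (l ^ 2 * z1) (z2 / l ^ 2)"
    and S: "\<And>x y1 y2 z1 z2. S *v mk5 x y1 y2 z1 z2 = mk5 x y2 y1 z2 z1"
    and invR: "\<And>x. q x = 0 \<Longrightarrow> q (R *v x) = 0"
    and invS: "\<And>x. q x = 0 \<Longrightarrow> q (S *v x) = 0"
  obtains a b c where "a \<noteq> 0" "b \<noteq> 0" "c \<noteq> 0"
    "\<And>x y1 y2 z1 z2. q (mk5 x y1 y2 z1 z2) = a * x ^ 2 + b * (y1 * y2) + c * (z1 * z2)"
proof -
  interpret quadratic_form q B by fact
  have l0: "l \<noteq> 0" using l(1) by auto
  obtain p where p: "p \<noteq> 0" "q p = 0"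
    using exists_isotropic assms(1) by blast
  obtain v where v: "B p v \<noteq> 0"
    using nonsing p by blast
  obtain c where c: "\<And>x. q (R *v x) = c * q x"
    using quadratic_form_dominated[OF assms(1) matrix invR p(2) v] by blast
  obtain d where d: "\<And>x. q (S *v x) = d * q x"
    using quadratic_form_dominated[OF assms(1) matrix invS p(2) v] by blast
  have "\<not> (\<forall>u. q u = 0)"
  proof
    assume "\<forall>u. q u = 0"
    then show False
      using v add[of p v] by simp
  qed
  then obtain u where u: "q u \<noteq> 0"
    by blast
  have "R *v (R *v (R *v (R *v (R *v u)))) = u"
  proof -
    obtain x y1 y2 z1 z2 where u: "u = mk5 x y1 y2 z1 z2" by (rule mk5_exhaust)
    have "l * (l * (l * (l * (l * y)))) = l ^ 5 * y" "y / l / l / l / l / l = y / l ^ 5" for y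
      by (simp_all add: eval_nat_numeral)
    moreover have "m ^ 2 * (m ^ 2 * (m ^ 2 * (m ^ 2 * (m ^ 2 * y)))) = (m ^ 5) ^ 2 * y"
      "y / m ^ 2 / m ^ 2 / m ^ 2 / m ^ 2 / m ^ 2 = y / (m ^ 5) ^ 2" for m y :: 'k
      by (simp_all flip: power_mult power_add add: mult.assoc[symmetric])
    moreover have "l ^ 10 = 1"
      using power_mult[of l 5 2] l(1) by simp
    ultimately show ?thesis
      unfolding u R mk5_inject by (simp add: l(1))
  qed
  then have "c * (c * (c * (c * (c * q u)))) = q u"
    using c by metis
  then have "c ^ 5 * q u = q u"
    by (simp add: eval_nat_numeral mult.assoc)
  then have c5: "c ^ 5 = 1" using u by simp
  have "S *v (R *v (S *v (R *v u))) = u"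
  proof -
    obtain x y1 y2 z1 z2 where u: "u = mk5 x y1 y2 z1 z2" by (rule mk5_exhaust)
    show ?thesis
      unfolding u R S mk5_inject using l0 by simp
  qed
  then have dc: "d * (c * (d * c)) = 1"
    using u c[of u] d[of "R *v u"] c[of "S *v (R *v u)"] d[of "R *v (S *v (R *v u))"]
    by (simp add: mult.assoc[symmetric])
  have "S *v (S *v u) = u"
    using S by (metis mk5_exhaust)
  then have dd: "d * d = 1"
    using u d[of u] d[of "S *v u"] by (simp add: mult.assoc[symmetric])
  have "c ^ 2 = 1"
  proof -
    have "d * (c * (d * c)) = (d * d) * c ^ 2"
      by (simp add: power2_eq_square)
    then show ?thesis
      using dd dc by simp
  qed
  then have "c = 1"
    using c5 power_add[of c "2 * 2" 1] power_mult[of c 2 2] by simp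
  then have qR: "q (R *v x) = q x" for x
    using c by simp
  have BR: "B (R *v x) (R *v y) = B x y" for x y
    using add[of x y] add[of "R *v x" "R *v y"] qR[of "x + y"] qR[of x] qR[of y]
    by (simp add: matrix_vector_right_distrib)
  define e0 e1 e2 e3 e4 where e: "e0 = mk5 1 0 0 0 (0::'k)" "e1 = mk5 0 1 0 0 (0::'k)"
    "e2 = mk5 0 0 1 0 (0::'k)" "e3 = mk5 0 0 0 1 (0::'k)" "e4 = mk5 0 0 0 0 (1::'k)"
  have Re: "R *v e0 = 1 *s e0" "R *v e1 = l *s e1" "R *v e2 = (1 / l) *s e2"
    "R *v e3 = (l ^ 2) *s e3" "R *v e4 = (1 / l ^ 2) *s e4"
    by (simp_all add: e R)
  have q0: "q x = 0" if "R *v x = m *s x" "m ^ 2 \<noteq> 1" for x m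
    using qR[of x] that by (simp add: scale)
  have B0: "B x y = 0" if "R *v x = m *s x" "R *v y = n *s y" "m * n \<noteq> 1" for x y m n
    using BR[of x y] that by (simp add: polar_simps mult.commute)
  \<comment> \<open>Since 2, 3 and 4 are prime to 5, none of these powers of \<open>l\<close> is 1;
    each identity rules out one exponent.\<close>
  have "l ^ 5 = l ^ 4 * l" "l ^ 4 = l ^ 2 * l ^ 2" "l ^ 5 * l = l ^ 3 * l ^ 3"
    by (simp_all add: eval_nat_numeral)
  then have "l ^ 2 \<noteq> 1" "l ^ 3 \<noteq> 1" "l ^ 4 \<noteq> 1"
    using l by (metis mult_1)+
  note ne = this l(2) l0
  have qe: "q e1 = 0" "q e2 = 0" "q e3 = 0" "q e4 = 0"
    using ne by (auto intro!: q0[OF Re(2)] q0[OF Re(3)] q0[OF Re(4)] q0[OF Re(5)]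
        simp: field_simps simp flip: power_mult)
  have Be: "B e0 e1 = 0" "B e0 e2 = 0" "B e0 e3 = 0" "B e0 e4 = 0" "B e1 e3 = 0" "B e1 e4 = 0"
    "B e2 e3 = 0" "B e2 e4 = 0"
    using ne by (auto intro!: B0[OF Re(1) Re(2)] B0[OF Re(1) Re(3)] B0[OF Re(1) Re(4)] B0[OF Re(1) Re(5)]
        B0[OF Re(2) Re(4)] B0[OF Re(2) Re(5)] B0[OF Re(3) Re(4)] B0[OF Re(3) Re(5)]
        simp: field_simps eval_nat_numeral)
  have mk5: "mk5 x y1 y2 z1 z2 = x *s e0 + y1 *s e1 + y2 *s e2 + z1 *s e3 + z2 *s e4" for x y1 y2 z1 z2
    by (simp add: e)
  have form: "q (mk5 x y1 y2 z1 z2) = q e0 * x ^ 2 + B e1 e2 * (y1 * y2) + B e3 e4 * (z1 * z2)" for x y1 y2 z1 z2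
    unfolding mk5 by (simp add: add scale polar_simps qe Be mult_ac)
  have ne0: "e0 \<noteq> 0" "e1 \<noteq> 0" "e3 \<noteq> 0"
    by (simp_all add: e)
  \<comment> \<open>Otherwise \<open>e0\<close> would be a singular point: isotropic and orthogonal
    to everything. The other two coefficients are treated alike.\<close>
  have "q e0 \<noteq> 0"
  proof
    assume 0: "q e0 = 0"
    then have "B e0 y = 0" for y
      by (cases y rule: mk5_exhaust) (simp add: mk5 polar_simps Be polar_self)
    then show False
      using nonsing[OF 0] ne0 by blast
  qed
  moreover have "B e1 e2 \<noteq> 0"
  proof
    assume 0: "B e1 e2 = 0"
    then have "B e1 y = 0" for y
      using Be(1) polar_commute[of e1 e0]
      by (cases y rule: mk5_exhaust) (simp add: mk5 polar_simps Be polar_self qe)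
    then show False
      using nonsing[of e1] qe ne0 by blast
  qed
  moreover have "B e3 e4 \<noteq> 0"
  proof
    assume 0: "B e3 e4 = 0"
    then have "B e3 y = 0" for y
      using Be(3,5,7) polar_commute[of e3 e0] polar_commute[of e3 e1] polar_commute[of e3 e2]
      by (cases y rule: mk5_exhaust) (simp add: mk5 polar_simps Be polar_self qe)
    then show False
      using nonsing[of e3] qe ne0 by blast
  qed
  ultimately show ?thesis
    using form by (rule that)
qed


section \<open>Dense open subsets of projective space and of quadrics\<close>

lemma span_scale_eq: "c \<noteq> 0 \<Longrightarrow> vec.span {c *s x} = vec.span {x}"
  by (cases "x = 0") (auto intro!: span_eq_of_mem simp: vec.span_base vec.span_scale)

lemma poly_curve_line: "poly_curve (\<lambda>t. w + t *s d)"
  unfolding poly_curve_def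
proof
  fix i
  show "\<exists>p. \<forall>t. (w + t *s d) $ i = poly p t"
    by (rule exI[of _ "[:w $ i, d $ i:]"]) simp
qed

lemma dense_open_in_proj_space:
  fixes h :: "'k::field_char_0 ^ 'n \<Rightarrow> 'k"
  assumes "form d h" "h u \<noteq> 0" "u \<noteq> 0"
  shows "dense_open_in proj_space (proj_space \<inter> nonvanishing h)"
proof (rule dense_open_in_nonvanishing[OF subset_refl assms(1)])
  fix L :: "('k ^ 'n) set" assume "L \<in> proj_space"
  then obtain x where x: "x \<noteq> 0" "L = vec.span {x}"
    by (auto simp: proj_space_iff)
  define d where "d = u - x"
  then have "x + d = u" by simp
  then show "\<exists>\<gamma>. poly_curve \<gamma> \<and> \<gamma> 0 \<noteq> 0 \<and> vec.span {\<gamma> 0} = L \<and> h (\<gamma> 1) \<noteq> 0 \<and>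
      (\<forall>t. \<gamma> t \<noteq> 0 \<longrightarrow> vec.span {\<gamma> t} \<in> proj_space)"
    by (intro exI[of _ "\<lambda>t. x + t *s d"])
      (use x assms(2) in \<open>auto simp: poly_curve_line proj_space_iff\<close>)
qed

text \<open>The required curve comes from stereographic parametrization at \<open>p\<close>, which
  sends \<open>v\<close> to its residual point. It is applied to the line from \<open>w\<close> to
  \<open>u\<close>: a tangent anisotropic \<open>w\<close> goes to a multiple of \<open>p\<close>,
  and an isotropic \<open>u\<close> to a multiple of itself.\<close>

lemma dense_open_in_quadric:
  fixes q :: "'k::field_char_0 ^ 'n \<Rightarrow> 'k"
  assumes "quadratic_form q B" and h: "form d h"
    and X: "X = {L \<in> proj_space. \<forall>x\<in>L. q x = 0}"
    and w: "\<And>p. q p = 0 \<Longrightarrow> p \<noteq> 0 \<Longrightarrow> \<exists>w. B p w = 0 \<and> q w \<noteq> 0"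
    and u: "\<And>p. q p = 0 \<Longrightarrow> p \<noteq> 0 \<Longrightarrow> \<exists>u. q u = 0 \<and> B p u \<noteq> 0 \<and> h u \<noteq> 0"
  shows "dense_open_in X (X \<inter> nonvanishing h)"
proof (rule dense_open_in_nonvanishing[OF _ h])
  interpret quadratic_form q B by fact
  show "X \<subseteq> proj_space"
    by (auto simp: X)
  fix L assume "L \<in> X"
  then obtain p where p: "p \<noteq> 0" "L = vec.span {p}" "q p = 0"
    by (auto simp: X proj_space_iff vec.span_base)
  obtain w u where w: "B p w = 0" "q w \<noteq> 0" and u: "q u = 0" "B p u \<noteq> 0" "h u \<noteq> 0"
    using w u p by metis
  define e where "e = u - w"
  define v where "v t = w + t *s e" for t
  define \<gamma> where "\<gamma> t = q (v t) *s p + (- B p (v t)) *s v t" for t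
  have "\<exists>r. \<forall>t. \<gamma> t $ i = poly r t" for i
  proof (rule exI, rule allI)
    fix t
    show "\<gamma> t $ i = poly ([:q w, B w e, q e:] * [:p $ i:]
        - [:B p w, B p e:] * [:w $ i, e $ i:]) t"
      unfolding \<gamma>_def v_def add scale polar_simps vector_add_component vector_smult_component
      by (simp add: power2_eq_square algebra_simps)
  qed
  then have "poly_curve \<gamma>"
    by (simp add: poly_curve_def)
  moreover have "\<gamma> 0 = q w *s p"
    by (simp add: \<gamma>_def v_def w)
  moreover have "\<gamma> 1 = (- B p u) *s u"
    by (simp add: \<gamma>_def v_def e_def u)
  moreover have "vec.span {\<gamma> t} \<in> X" if "\<gamma> t \<noteq> 0" for t
  proof -
    have "q (\<gamma> t) = 0"
      unfolding \<gamma>_def by (rule isotropic_residual[OF p(3)])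
    then show ?thesis
      using that by (auto simp: X proj_space_iff vec.span_singleton scale)
  qed
  ultimately show "\<exists>\<gamma>. poly_curve \<gamma> \<and> \<gamma> 0 \<noteq> 0 \<and> vec.span {\<gamma> 0} = L \<and> h (\<gamma> 1) \<noteq> 0 \<and>
      (\<forall>t. \<gamma> t \<noteq> 0 \<longrightarrow> vec.span {\<gamma> t} \<in> X)"
    using p w u form_scale[OF h, of "- B p u" u]
    by (intro exI[of _ \<gamma>]) (simp add: span_scale_eq)
qed

section \<open>Rational maps given by forms\<close>

text \<open>This allows the map on points to be defined as the span of the image of a line, without
  choosing a representative.\<close>

lemma span_image_forms:
  assumes "\<And>j. form a (\<lambda>x. \<phi> x $ j)"
  shows "vec.span (\<phi> ` vec.span {x}) = vec.span {\<phi> x}"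
proof
  have "\<phi> (c *s x) = c ^ a *s \<phi> x" for c
    by (simp add: vec_eq_iff form_scale[OF assms])
  then have "\<phi> ` vec.span {x} \<subseteq> vec.span {\<phi> x}"
    by (auto simp: vec.span_singleton)
  then show "vec.span (\<phi> ` vec.span {x}) \<subseteq> vec.span {\<phi> x}"
    by (simp add: vec.span_minimal)
  show "vec.span {\<phi> x} \<subseteq> vec.span (\<phi> ` vec.span {x})"
    by (intro vec.span_mono) (simp add: vec.span_base)
qed

text \<open>A single tuple of forms describes the map everywhere, so \<open>U\<close> itself serves
  as the neighbourhood of each point.\<close>

lemma regular_map_onI:
  assumes "\<And>j. form a (\<lambda>x. \<phi> x $ j)" "U \<subseteq> proj_space"
    and f: "\<And>L. L \<in> U \<Longrightarrow> f L = vec.span (\<phi> ` L)"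
    and nz: "\<And>L x. L \<in> U \<Longrightarrow> x \<in> L \<Longrightarrow> x \<noteq> 0 \<Longrightarrow> \<phi> x \<noteq> 0"
  shows "regular_map_on U f"
  unfolding regular_map_on_def
proof (rule ballI)
  fix p assume p: "p \<in> U"
  obtain F where F: "\<And>j. homogeneous a (F j)" "\<And>j. eval_mvpoly (F j) = (\<lambda>x. \<phi> x $ j)"
    using assms(1) unfolding form_def by metis
  have "(\<chi> j. eval_mvpoly (F j) x) = \<phi> x" for x
    by (simp add: F(2))
  moreover have "f q = vec.span {\<phi> x}" if "q \<in> U" "x \<in> q" "x \<noteq> 0" for q x
    using f[OF that(1)] proj_space_mem[of q x] assms(2) that span_image_forms[OF assms(1), of x] by auto
  moreover have "openin (subtopology zariski U) U"
    using assms(2) by (metis inf.absorb_iff2 openin_topspace topspace_subtopology topspace_zariski)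
  ultimately show "\<exists>N d F. openin (subtopology zariski U) N \<and> p \<in> N \<and> (\<forall>j. homogeneous d (F j)) \<and>
      (\<forall>q\<in>N. \<forall>x\<in>q - {0}. (\<chi> j. eval_mvpoly (F j) x) \<noteq> 0 \<and> f q = vec.span {\<chi> j. eval_mvpoly (F j) x})"
    using p F(1) nz by (intro exI[of _ U] exI[of _ a] exI[of _ F]) simp
qed

text \<open>Everything is checked on vectors: the composites need only be nonzero multiples of the
  identity. Equivariance of the forms themselves gives equivariance at every point, with no
  condition on the domain.\<close>

lemma equivariantly_birationalI:
  fixes \<phi> :: "'k::field ^ 'n::finite \<Rightarrow> 'k ^ 'm::finite" and \<psi> :: "'k ^ 'm \<Rightarrow> 'k ^ 'n"
  assumes X: "X \<subseteq> proj_space" and Y: "Y \<subseteq> proj_space"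
    and h: "form d h" and k: "form e k"
    and dense: "dense_open_in X (X \<inter> nonvanishing h)" "dense_open_in Y (Y \<inter> nonvanishing k)"
    and \<phi>: "\<And>j. form a (\<lambda>x. \<phi> x $ j)" and \<psi>: "\<And>i. form b (\<lambda>x. \<psi> x $ i)"
    and XY: "\<And>x. x \<noteq> 0 \<Longrightarrow> vec.span {x} \<in> X \<Longrightarrow> h x \<noteq> 0 \<Longrightarrow>
      \<phi> x \<noteq> 0 \<and> vec.span {\<phi> x} \<in> Y \<and> k (\<phi> x) \<noteq> 0 \<and> (\<exists>c. c \<noteq> 0 \<and> \<psi> (\<phi> x) = c *s x)"
    and YX: "\<And>y. y \<noteq> 0 \<Longrightarrow> vec.span {y} \<in> Y \<Longrightarrow> k y \<noteq> 0 \<Longrightarrow>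
      \<psi> y \<noteq> 0 \<and> vec.span {\<psi> y} \<in> X \<and> h (\<psi> y) \<noteq> 0 \<and> (\<exists>c. c \<noteq> 0 \<and> \<phi> (\<psi> y) = c *s y)"
    and equiv: "\<And>g x. g \<in> carrier G \<Longrightarrow> \<phi> (\<rho> g *v x) = \<tau> g *v \<phi> x"
  shows "equivariantly_birational G \<rho> X \<tau> Y"
proof -
  define U V where "U = X \<inter> nonvanishing h" "V = Y \<inter> nonvanishing k"
  define f g where "f L = vec.span (\<phi> ` L)" "g M = vec.span (\<psi> ` M)" for L M
  have U: "\<exists>x. x \<noteq> 0 \<and> L = vec.span {x} \<and> vec.span {x} \<in> X \<and> h x \<noteq> 0" if "L \<in> U" for L
    using that X by (auto simp: U_V_def nonvanishing_def proj_space_iff)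
       (metis that IntE U_V_def(1) span_in_nonvanishing[OF h])
  have V: "\<exists>y. y \<noteq> 0 \<and> M = vec.span {y} \<and> vec.span {y} \<in> Y \<and> k y \<noteq> 0" if "M \<in> V" for M
    using that Y by (auto simp: U_V_def nonvanishing_def proj_space_iff)
       (metis that IntE U_V_def(2) span_in_nonvanishing[OF k])
  have f: "f (vec.span {x}) = vec.span {\<phi> x}" for x
    unfolding f_g_def by (rule span_image_forms[OF \<phi>])
  have g: "g (vec.span {y}) = vec.span {\<psi> y}" for y
    unfolding f_g_def by (rule span_image_forms[OF \<psi>])
  have fU: "f L \<in> V \<and> g (f L) = L" if L: "L \<in> U" for L
  proof -
    obtain x where x: "x \<noteq> 0" "L = vec.span {x}" "vec.span {x} \<in> X" "h x \<noteq> 0"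
      using U[OF L] by blast
    then show ?thesis
      using XY[OF x(1,3,4)] by (auto simp: f g U_V_def span_in_nonvanishing[OF k] span_scale_eq)
  qed
  have gV: "g M \<in> U \<and> f (g M) = M" if M: "M \<in> V" for M
  proof -
    obtain y where y: "y \<noteq> 0" "M = vec.span {y}" "vec.span {y} \<in> Y" "k y \<noteq> 0"
      using V[OF M] by blast
    then show ?thesis
      using YX[OF y(1,3,4)] by (auto simp: f g U_V_def span_in_nonvanishing[OF h] span_scale_eq)
  qed
  have bij: "bij_betw f U V"
    by (rule bij_betw_byWitness[where f' = g]) (use fU gV in auto)
  have inv: "inv_into U f M = g M" if "M \<in> V" for M
    by (metis bij bij_betw_def gV inv_into_f_eq that)
  have "regular_map_on U f"
  proof (rule regular_map_onI[OF \<phi>])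
    fix L x assume L: "L \<in> U" "x \<in> L" "x \<noteq> 0"
    then have "L = vec.span {x}"
      using X proj_space_mem[of L x] by (auto simp: U_V_def)
    then show "\<phi> x \<noteq> 0"
      using L XY[of x] span_in_nonvanishing[OF h, of x] by (auto simp: U_V_def)
  qed (use X in \<open>auto simp: U_V_def f_g_def\<close>)
  moreover have "regular_map_on V (inv_into U f)"
  proof (rule regular_map_onI[OF \<psi>])
    fix M y assume M: "M \<in> V" "y \<in> M" "y \<noteq> 0"
    then have "M = vec.span {y}"
      using Y proj_space_mem[of M y] by (auto simp: U_V_def)
    then show "\<psi> y \<noteq> 0"
      using M YX[of y] span_in_nonvanishing[OF k, of y] by (auto simp: U_V_def)
  next
    fix M assume "M \<in> V"
    then show "inv_into U f M = vec.span (\<psi> ` M)"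
      using inv by (simp add: f_g_def)
  qed (use Y in \<open>auto simp: U_V_def\<close>)
  moreover have "f (proj_action (\<rho> s) p) = proj_action (\<tau> s) (f p)" if "s \<in> carrier G" for s p
    unfolding f_g_def proj_action_def image_image equiv[OF that]
    by (simp flip: image_image[of "(*v) (\<tau> s)" \<phi>] add: vec.span_image)
  ultimately show ?thesis
    unfolding equivariantly_birational_def using dense bij
    by (intro exI[of _ U] exI[of _ V] exI[of _ f]) (auto simp: U_V_def)
qed

text \<open>The quadric \<open>x\<^sup>2 = y\<^sub>1 y\<^sub>2 + z\<^sub>1 z\<^sub>2\<close> is fibred by quadric surfaces over the line with coordinate
  \<open>[y\<^sub>1 : y\<^sub>2]\<close>, with the equivariant section \<open>(y\<^sub>1 y\<^sub>2, 0, 0, y\<^sub>1\<^sup>2, y\<^sub>2\<^sup>2)\<close>; the map below is the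
  projection of the fibres from this section.\<close>

definition quadric_to_proj :: "'k::field ^ (1 + 2 + 2) \<Rightarrow> 'k ^ 4" where
  "quadric_to_proj v = (let x = v $ Inl 1; y1 = v $ Inr (Inl 1); y2 = v $ Inr (Inl 2);
      z1 = v $ Inr (Inr 1); z2 = v $ Inr (Inr 2)
    in vector [y1 * y1 * y2, y1 * y2 * y2, y1 * y2 * x - y2 * y2 * z1, y1 * y2 * x - y1 * y1 * z2])"

text \<open>For nonzero a and b this is, up to sign, the point of \<open>isotropic_residual\<close>
  for the section (a b, 0, 0, a^2, b^2) and the vector (0, a, b, - a p / b, - b q / a). The latter
  is the vector with x = 0 in the fibre over [a : b] that projects to [a : b : p : q].\<close>

definition proj_to_quadric :: "'k::field ^ 4 \<Rightarrow> 'k ^ (1 + 2 + 2)" where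
  "proj_to_quadric u = (let a = u $ 1; b = u $ 2; p = u $ 3; q = u $ 4
    in mk5 (a * b * (p * q + a * b)) (a * a * b * (p + q)) (a * b * b * (p + q))
      (a * a * (a * b - p * p)) (b * b * (a * b - q * q)))"

section \<open>The standard quadric and the two charts\<close>

definition std_quadric :: "'k::field ^ (1 + 2 + 2) \<Rightarrow> 'k" where
  "std_quadric v = v $ Inl 1 * v $ Inl 1 - v $ Inr (Inl 1) * v $ Inr (Inl 2)
    - v $ Inr (Inr 1) * v $ Inr (Inr 2)"

definition std_polar :: "'k::field ^ (1 + 2 + 2) \<Rightarrow> 'k ^ (1 + 2 + 2) \<Rightarrow> 'k" where
  "std_polar v w = 2 * (v $ Inl 1 * w $ Inl 1)
    - v $ Inr (Inl 1) * w $ Inr (Inl 2) - v $ Inr (Inl 2) * w $ Inr (Inl 1)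
    - v $ Inr (Inr 1) * w $ Inr (Inr 2) - v $ Inr (Inr 2) * w $ Inr (Inr 1)"

text \<open>The last factor is \<open>std_polar\<close> of the section (y1 y2, 0, 0, y1^2, y2^2)
  with \<open>v\<close>. It vanishes when \<open>v\<close> lies in the tangent plane of its fibre at
  the section, where the projection cannot be inverted.\<close>

definition quadric_chart :: "'k::field ^ (1 + 2 + 2) \<Rightarrow> 'k" where
  "quadric_chart v = (let x = v $ Inl 1; y1 = v $ Inr (Inl 1); y2 = v $ Inr (Inl 2);
      z1 = v $ Inr (Inr 1); z2 = v $ Inr (Inr 2)
    in y1 * y2 * ((y1 * y2 * x - y2 * y2 * z1) + (y1 * y2 * x - y1 * y1 * z2)))"

definition proj_chart :: "'k::field ^ 4 \<Rightarrow> 'k" where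
  "proj_chart u = u $ 1 * u $ 2 * (u $ 3 + u $ 4)"

lemma vector_4 [simp]:
  "(vector [a, b, c, d] :: 'k::zero ^ 4) $ 1 = a" "(vector [a, b, c, d] :: 'k ^ 4) $ 2 = b"
  "(vector [a, b, c, d] :: 'k ^ 4) $ 3 = c" "(vector [a, b, c, d] :: 'k ^ 4) $ 4 = d"
  by (simp_all add: vector_def)

lemma quadratic_form_std: "quadratic_form std_quadric std_polar"
  by unfold_locales (simp_all add: std_quadric_def std_polar_def algebra_simps power2_eq_square)

lemma proj_to_quadric_to_proj:
  assumes "std_quadric v = 0" "quadric_chart v \<noteq> 0"
  shows "\<exists>c. c \<noteq> 0 \<and> proj_to_quadric (quadric_to_proj v) = c *s v"
proof -
  obtain x y1 y2 z1 z2 where v: "v = mk5 x y1 y2 z1 z2" by (rule mk5_exhaust)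
  let ?s = "(y1 * y2 * x - y2 * y2 * z1) + (y1 * y2 * x - y1 * y1 * z2)"
  have eq: "x * x = y1 * y2 + z1 * z2"
    using assms(1) unfolding std_quadric_def v mk5_nth by algebra
  have "y1 * y2 * ?s \<noteq> 0"
    using assms(2) by (simp add: quadric_chart_def v)
  then have "(y1 * y2) ^ 4 * ?s \<noteq> 0"
    by simp
  moreover have "proj_to_quadric (quadric_to_proj v) = ((y1 * y2) ^ 4 * ?s) *s v"
  proof -
    let ?p = "y1 * y2 * x - y2 * y2 * z1" and ?q = "y1 * y2 * x - y1 * y1 * z2"
    \<comment> \<open>Modulo the equation of the quadric, every coordinate acquires the common
      factor \<open>?s\<close>.\<close>
    have "?p * ?q + y1 * y1 * y2 * (y1 * y2 * y2) = y1 * y2 * x * ?s"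
      "y1 * y1 * y2 * (y1 * y2 * y2) - ?p * ?p = y2 * y2 * (?s * z1)"
      "y1 * y1 * y2 * (y1 * y2 * y2) - ?q * ?q = y1 * y1 * (?s * z2)"
      using eq by algebra+
    then show ?thesis
      unfolding v proj_to_quadric_def quadric_to_proj_def Let_def mk5_nth vector_4 mk5_scale mk5_inject
      by (simp add: eval_nat_numeral mult_ac)
  qed
  ultimately show ?thesis by blast
qed

lemma quadric_to_proj_to_quadric:
  "quadric_to_proj (proj_to_quadric u) = ((u $ 1 * u $ 2) ^ 4 * (u $ 3 + u $ 4) ^ 3) *s u"
  unfolding quadric_to_proj_def proj_to_quadric_def Let_def mk5_nth vec_eq_iff forall_4 vector_4
    vector_smult_component
  by (intro conjI) algebra+

lemma std_quadric_proj_to_quadric: "std_quadric (proj_to_quadric u) = 0"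
  unfolding std_quadric_def proj_to_quadric_def Let_def mk5_nth by algebra

lemma proj_chart_quadric_to_proj: "proj_chart (quadric_to_proj v) \<noteq> 0" if "quadric_chart v \<noteq> 0"
  using that unfolding proj_chart_def quadric_to_proj_def quadric_chart_def Let_def vector_4 by auto

lemma quadric_chart_proj_to_quadric: "quadric_chart (proj_to_quadric u) \<noteq> 0" if "proj_chart u \<noteq> 0"
proof -
  have "quadric_chart (proj_to_quadric u) = (u $ 1 * u $ 2) ^ 7 * (u $ 3 + u $ 4) ^ 6"
    unfolding quadric_chart_def proj_to_quadric_def Let_def mk5_nth by algebra
  then show ?thesis
    using that by (auto simp: proj_chart_def)
qed

text \<open>Provides the starting vector \<open>w\<close> for \<open>dense_open_in_quadric\<close>.
  If x is nonzero, the equation makes y1 y2 or z1 z2 nonzero, and changing one sign within that pair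
  gives an orthogonal vector.\<close>

lemma std_quadric_orthogonal_anisotropic:
  assumes "std_quadric p = 0" "p \<noteq> (0 :: 'k::field_char_0 ^ (1 + 2 + 2))"
  shows "\<exists>w. std_polar p w = 0 \<and> std_quadric w \<noteq> 0"
proof -
  obtain x y1 y2 z1 z2 where p: "p = mk5 x y1 y2 z1 z2" by (rule mk5_exhaust)
  have eq: "x * x = y1 * y2 + z1 * z2"
    using assms(1) unfolding std_quadric_def p mk5_nth by algebra
  consider "x = 0" | "y1 * y2 \<noteq> 0" | "z1 * z2 \<noteq> 0"
    using eq by force
  then show ?thesis
  proof cases
    case 1
    then show ?thesis
      by (intro exI[of _ "mk5 1 0 0 0 0"]) (simp add: p std_polar_def std_quadric_def)
  next
    case 2
    then show ?thesis
      by (intro exI[of _ "mk5 0 y1 (- y2) 0 0"]) (simp add: p std_polar_def std_quadric_def)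
  next
    case 3
    then show ?thesis
      by (intro exI[of _ "mk5 0 0 0 z1 (- z2)"]) (simp add: p std_polar_def std_quadric_def)
  qed
qed

text \<open>The chart contains five linearly independent points of the quadric, obtained from
  \<open>proj_to_quadric\<close>; a vector orthogonal to all of them is 0.\<close>

lemma std_quadric_nondegenerate_chart:
  assumes "p \<noteq> (0 :: 'k::field_char_0 ^ (1 + 2 + 2))"
  shows "\<exists>u. std_quadric u = 0 \<and> std_polar p u \<noteq> 0 \<and> quadric_chart u \<noteq> 0"
proof (rule ccontr)
  assume "\<nexists>u. std_quadric u = 0 \<and> std_polar p u \<noteq> 0 \<and> quadric_chart u \<noteq> 0"
  then have *: "std_polar p (proj_to_quadric u) = 0" if "proj_chart u \<noteq> 0" for u
    using std_quadric_proj_to_quadric quadric_chart_proj_to_quadric that by blast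
  obtain x y1 y2 z1 z2 where p: "p = mk5 x y1 y2 z1 z2" by (rule mk5_exhaust)
  have "2 * (x * 2) - y1 * 2 - y2 * 2 = 0"
    using *[of "vector [1, 1, 1, 1]"]
    by (simp add: proj_chart_def proj_to_quadric_def std_polar_def p algebra_simps)
  moreover have "2 * x - y1 - y2 - z2 = 0"
    using *[of "vector [1, 1, 0, 1]"]
    by (simp add: proj_chart_def proj_to_quadric_def std_polar_def p algebra_simps)
  moreover have "2 * x - y1 - y2 - z1 = 0"
    using *[of "vector [1, 1, 1, 0]"]
    by (simp add: proj_chart_def proj_to_quadric_def std_polar_def p algebra_simps)
  moreover have "- (2 * x) - y1 - y2 + 3 * z2 = 0"
    using *[of "vector [1, 1, 2, -1]"]
    by (simp add: proj_chart_def proj_to_quadric_def std_polar_def p algebra_simps)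
  \<comment> \<open>The four points above have equal first two coordinates and see only y1 + y2;
    this one separates y1 from y2.\<close>
  moreover have "12 * x - y1 * 4 - y2 * 8 - z1 - 4 * z2 = 0"
    using *[of "vector [2, 1, 1, 1]"]
    by (simp add: proj_chart_def proj_to_quadric_def std_polar_def p algebra_simps)
  ultimately have "p = 0"
    unfolding p mk5_zero_iff by algebra
  with assms show False by simp
qed


section \<open>Two-dimensional representations of the dihedral group of order 10\<close>

text \<open>With z = l^a this is the matrix of r^a s^b in a basis of eigenvectors of r exchanged by
  s, the first with eigenvalue l.\<close>

definition dihedral_mat :: "'k::field \<Rightarrow> bool \<Rightarrow> 'k ^ 2 ^ 2" where
  "dihedral_mat z b = (if b then vector [vector [0, z], vector [1 / z, 0]]
    else vector [vector [z, 0], vector [0, 1 / z]])"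

lemma dihedral_mat_mult_vec:
  "dihedral_mat z b *v u = (if b then vector [z * u $ 2, u $ 1 / z] else vector [z * u $ 1, u $ 2 / z])"
  by (simp add: dihedral_mat_def vec_eq_iff matrix_vector_mult_def sum_2 forall_2)

text \<open>Exchanging the two eigenvectors inverts the eigenvalue, so l and 1 / l give isomorphic
  representations.\<close>

lemma dihedral_mat_flip:
  assumes "z \<noteq> 0"
  shows "dihedral_mat 1 True ** dihedral_mat z b = dihedral_mat (1 / z) b ** dihedral_mat 1 True"
  unfolding matrix_eq matrix_vector_mul_assoc[symmetric]
  using assms by (simp add: dihedral_mat_mult_vec vec_eq_iff forall_2)

lemma invertible_dihedral_flip: "invertible (dihedral_mat (1::'k::field) True)"
proof -
  have "dihedral_mat (1::'k) True ** dihedral_mat 1 True = mat 1"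
    unfolding matrix_eq matrix_vector_mul_assoc[symmetric]
    by (simp add: dihedral_mat_mult_vec vec_eq_iff forall_2)
  then show ?thesis
    by (auto simp: invertible_def)
qed

lemma eigenvector_exists_2:
  fixes A :: "'k::alg_closed_field ^ 2 ^ 2"
  obtains v l where "v \<noteq> 0" "A *v v = l *s v"
proof (cases "A $ 1 $ 2 = 0")
  case True
  then show ?thesis
    by (intro that[of "vector [0, 1]" "A $ 2 $ 2"])
      (simp_all add: vec_eq_iff forall_2 matrix_vector_mult_def sum_2)
next
  case False
  let ?p = "[:A $ 1 $ 1 * A $ 2 $ 2 - A $ 1 $ 2 * A $ 2 $ 1, - (A $ 1 $ 1 + A $ 2 $ 2), 1:]"
  have "degree ?p > 0" by simp
  then obtain l where "poly ?p l = 0"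
    using alg_closed_imp_poly_has_root by blast
  then have l: "A $ 1 $ 1 * A $ 2 $ 2 - A $ 1 $ 2 * A $ 2 $ 1 - (A $ 1 $ 1 + A $ 2 $ 2) * l + l * l = 0"
    by (simp add: algebra_simps)
  have "A $ 2 $ 1 * A $ 1 $ 2 + A $ 2 $ 2 * (l - A $ 1 $ 1) = l * (l - A $ 1 $ 1)"
    using l by algebra
  then show ?thesis
    \<comment> \<open>The vector solves the first row of the eigenvalue equation; the second row is
      the characteristic equation.\<close>
    using False by (intro that[of "vector [A $ 1 $ 2, l - A $ 1 $ 1]" l])
      (simp_all add: vec_eq_iff forall_2 matrix_vector_mult_def sum_2 algebra_simps)
qed

lemma power_int_mod_5:
  fixes l :: "'k::field"
  assumes "l ^ 5 = 1"
  shows "l powi (a mod 5) = l powi a"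
proof -
  have l: "l \<noteq> 0" "l powi 5 = 1"
    using assms by auto
  have "l powi a = l powi (5 * (a div 5) + a mod 5)"
    by simp
  also have "\<dots> = l powi (a mod 5)"
    using l by (subst power_int_add) (simp_all add: power_int_mult)
  finally show ?thesis ..
qed

lemma dihedral_5_carrier: "carrier (dihedral_group 5) = {0..<5} \<times> UNIV"
  and dihedral_5_mult: "(a, b) \<otimes>\<^bsub>dihedral_group 5\<^esub> (c, d) = ((if b then a - c else a + c) mod 5, b \<noteq> d)"
  and dihedral_5_one: "\<one>\<^bsub>dihedral_group 5\<^esub> = (0, False)"
  by (simp_all add: dihedral_group_def)

text \<open>An eigenvector \<open>v\<close> of the rotation for \<open>l\<close> is sent by the
  reflection to one for \<open>1 / l\<close>. Irreducibility excludes l = 1; then the two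
  eigenvalues differ, and \<open>P\<close> is the inverse of the matrix with columns
  \<open>v\<close> and \<open>w\<close>.\<close>

lemma dihedral_5_irreducible_rep:
  fixes \<sigma> :: "int \<times> bool \<Rightarrow> 'k::{alg_closed_field, field_char_0} ^ 2 ^ 2"
  assumes irr: "irreducible_rep (dihedral_group 5) \<sigma>"
  obtains P l where "invertible P" "l ^ 5 = 1" "l \<noteq> 1"
    "\<And>a b. a \<in> {0..<5} \<Longrightarrow> P ** \<sigma> (a, b) = dihedral_mat (l powi a) b ** P"
proof -
  have one: "\<sigma> (0, False) = mat 1"
    using irr by (simp add: irreducible_rep_def linear_rep_def dihedral_5_one)
  have mult: "\<sigma> ((if b then a - c else a + c) mod 5, b \<noteq> d) = \<sigma> (a, b) ** \<sigma> (c, d)"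
    if "a \<in> {0..<5}" "c \<in> {0..<5}" for a b c d
  proof -
    have "(a, b) \<in> carrier (dihedral_group 5)" "(c, d) \<in> carrier (dihedral_group 5)"
      using that by (simp_all add: dihedral_5_carrier)
    then show ?thesis
      using irr unfolding irreducible_rep_def linear_rep_def dihedral_5_mult[symmetric] by blast
  qed
  define R S where "R = \<sigma> (1, False)" "S = \<sigma> (0, True)"
  have SS: "S ** S = mat 1"
    using mult[of 0 0 True True] one by (simp add: R_S_def)
  have RSR: "(R ** S) ** R = S"
    using mult[of 1 0 False True] mult[of 1 1 True False] by (simp add: R_S_def)
  have refl: "\<sigma> (a, True) = \<sigma> (a, False) ** S" if "a \<in> {0..<5}" for a
    using mult[of a 0 False True] that by (simp add: R_S_def)
  have pow: "\<sigma> (int m mod 5, False) *v x = c ^ m *s x" if "R *v x = c *s x" for m c x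
  proof (induction m)
    case 0
    then show ?case by (simp add: one)
  next
    case (Suc m)
    have "\<sigma> (int (Suc m) mod 5, False) = \<sigma> (int m mod 5, False) ** R"
      using mult[of "int m mod 5" 1 False False] by (simp add: R_S_def mod_simps add.commute)
    then show ?case
      using that Suc.IH
      by (simp add: matrix_vector_mul_assoc[symmetric] vector_scalar_commute vector_smult_assoc)
  qed
  have pow': "\<sigma> (a, False) *v x = c powi a *s x" if "R *v x = c *s x" "a \<in> {0..<5}" for a c x
    using pow[OF that(1), of "nat a"] that(2) by (simp add: power_int_def)
  obtain v l where v: "v \<noteq> 0" "R *v v = l *s v"
    by (rule eigenvector_exists_2)
  define w where "w = S *v v"
  have Sw: "S *v w = v"
    using SS by (simp add: w_def matrix_vector_mul_assoc)
  have w0: "w \<noteq> 0"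
    using Sw v(1) by auto
  have l5: "l ^ 5 = 1"
    using pow[OF v(2), of 5] v(1) by (simp add: one) (metis vec.scale_cancel_right vec.scale_one)
  then have l0: "l \<noteq> 0" by auto
  have "l *s (R *v w) = R *v (S *v (R *v v))"
    by (simp add: v w_def vector_scalar_commute)
  also have "\<dots> = w"
    using RSR by (simp add: w_def matrix_vector_mul_assoc matrix_mul_assoc)
  finally have "(1 / l) *s w = (1 / l) *s (l *s (R *v w))" by simp
  then have Rw: "R *v w = (1 / l) *s w"
    using l0 by (simp add: vector_smult_assoc)
  have no_line: False if "u \<noteq> 0" "R *v u = u" "S *v u = c *s u" for u c
  proof -
    have line: "\<sigma> (a, b) *v u \<in> vec.span {u}" if "a \<in> {0..<5}" for a b
      using pow'[of u 1 a] \<open>R *v u = u\<close> \<open>S *v u = c *s u\<close> refl[OF that] that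
      by (cases b) (simp_all add: matrix_vector_mul_assoc[symmetric] vector_scalar_commute
          vec.span_base vec.span_scale)
    have "\<sigma> g *v x \<in> vec.span {u}"
      if g: "g \<in> carrier (dihedral_group 5)" and "x \<in> vec.span {u}" for g x
    proof -
      obtain k where "x = k *s u"
        using \<open>x \<in> vec.span {u}\<close> by (auto simp: vec.span_singleton)
      moreover have "\<sigma> g *v u \<in> vec.span {u}"
        using g line by (auto simp: dihedral_5_carrier)
      ultimately show ?thesis
        by (simp add: vector_scalar_commute vec.span_scale)
    qed
    then have "\<forall>g \<in> carrier (dihedral_group 5). (*v) (\<sigma> g) ` vec.span {u} \<subseteq> vec.span {u}"
      by blast
    then have "vec.span {u} = {0} \<or> vec.span {u} = UNIV"
      using irr vec.subspace_span unfolding irreducible_rep_def by blast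
    moreover have "u \<in> vec.span {u}"
      by (simp add: vec.span_base)
    moreover have "vec.dim (vec.span {u}) = 1"
      using that(1) by (simp add: vec.dim_eq_card_independent)
    then have "vec.dim (vec.span {u}) \<noteq> vec.dim (UNIV :: ('k ^ 2) set)"
      unfolding vec_dim_card by simp
    then have "vec.span {u} \<noteq> UNIV"
      by metis
    ultimately show False
      using that(1) by auto
  qed
  have l1: "l \<noteq> 1"
  proof
    assume l: "l = 1"
    show False
    \<comment> \<open>The vector \<open>v + w\<close> is fixed by the reflection; if it is zero,
      \<open>v\<close> itself is reflected to its negative. Either way there is an invariant
      line.\<close>
    proof (cases "v + w = 0")
      case True
      then have "w = (- 1) *s v"
        by (simp add: eq_neg_iff_add_eq_0 add.commute)
      then show False
        using no_line[of v "- 1"] v l by (simp add: w_def)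
    next
      case False
      then show False
        using no_line[of "v + w" 1] v(2) Rw Sw l
        by (simp add: matrix_vector_right_distrib w_def[symmetric] add.commute)
    qed
  qed
  have ll: "l \<noteq> 1 / l"
  proof
    assume "l = 1 / l"
    then have "l * l = 1"
      using l0 by (metis divide_self_if times_divide_eq_right mult.right_neutral)
    moreover have "l ^ 5 = (l * l) * (l * l) * l"
      by (simp add: eval_nat_numeral)
    ultimately show False
      using l5 l1 by simp
  qed
  define M :: "'k ^ 2 ^ 2" where "M = (\<chi> i j. if j = 1 then v $ i else w $ i)"
  have M: "M *v u = u $ 1 *s v + u $ 2 *s w" for u
    by (simp add: M_def vec_eq_iff matrix_vector_mult_def sum_2 mult.commute)
  have "u = 0" if "M *v u = 0" for u
  proof -
    have 1: "u $ 1 *s v + u $ 2 *s w = 0"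
      using that by (simp add: M)
    then have "R *v (u $ 1 *s v + u $ 2 *s w) = 0"
      by simp
    then have "(u $ 1 * l) *s v + (u $ 2 * (1 / l)) *s w = 0"
      by (simp add: matrix_vector_right_distrib vector_scalar_commute v Rw vector_smult_assoc)
    moreover have "(1 / l) *s (u $ 1 *s v + u $ 2 *s w) = 0"
      by (simp add: 1)
    \<comment> \<open>Subtracting \<open>1 / l\<close> times the relation from its image under
      \<open>R\<close> eliminates \<open>w\<close>.\<close>
    ultimately have "(u $ 1 * (l - 1 / l)) *s v = 0"
      by (simp add: vec_eq_iff algebra_simps) (metis add_right_imp_eq)
    then have "u $ 1 = 0"
      using v(1) ll by (simp add: vec.scale_eq_0_iff)
    moreover from this have "u $ 2 = 0"
      using 1 w0 by simp
    ultimately show ?thesis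
      by (simp add: vec_eq_iff forall_2)
  qed
  then obtain P where P: "P ** M = mat 1" "M ** P = mat 1"
    using matrix_left_invertible_ker matrix_left_right_inverse by metis
  have "P ** \<sigma> (a, b) = dihedral_mat (l powi a) b ** P" if a: "a \<in> {0..<5}" for a b
  proof -
    have "\<sigma> (a, b) ** M = M ** dihedral_mat (l powi a) b"
      unfolding matrix_eq
    proof
      fix u :: "'k ^ 2"
      have "(1 / l) powi a = 1 / l powi a"
        by (simp add: power_int_divide_distrib)
      then have "\<sigma> (a, False) *v v = l powi a *s v" "\<sigma> (a, False) *v w = (1 / l powi a) *s w"
        using pow'[OF v(2) a] pow'[OF Rw a] by simp_all
      then show "\<sigma> (a, b) ** M *v u = M ** dihedral_mat (l powi a) b *v u"
        using refl[OF a] Sw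
        by (cases b) (simp_all add: matrix_vector_mul_assoc[symmetric] M dihedral_mat_mult_vec
            matrix_vector_right_distrib vector_scalar_commute vector_smult_assoc
            w_def[symmetric] mult.commute add.commute)
    qed
    then have "P ** (\<sigma> (a, b) ** M) ** P = P ** (M ** dihedral_mat (l powi a) b) ** P"
      by simp
    then show ?thesis
      by (simp add: matrix_mul_assoc P) (simp add: matrix_mul_assoc[symmetric] P)
  qed
  moreover have "invertible P"
    using P by (auto simp: invertible_def)
  ultimately show ?thesis
    using that l5 l1 by blast
qed

text \<open>The polynomial 1 + X + X^2 + X^3 + X^4 factors with roots l, l^2, l^3, l^4, and
  \<open>m\<close> is one of its zeros.\<close>

lemma fifth_roots_of_unity:
  fixes l m :: "'k::field"
  assumes "l ^ 5 = 1" "m ^ 5 = 1" "l \<noteq> 1" "m \<noteq> 1"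
  shows "m = l \<or> m = 1 / l \<or> m = l ^ 2 \<or> m = 1 / l ^ 2"
proof -
  have "(l - 1) * (1 + l + l ^ 2 + l ^ 3 + l ^ 4) = l ^ 5 - 1"
    "(m - 1) * (1 + m + m ^ 2 + m ^ 3 + m ^ 4) = m ^ 5 - 1"
    by (simp_all add: eval_nat_numeral algebra_simps)
  then have "1 + l + l ^ 2 + l ^ 3 + l ^ 4 = 0" "1 + m + m ^ 2 + m ^ 3 + m ^ 4 = 0"
    using assms by auto
  then have "(m - l) * (m - l ^ 2) * (m - l ^ 3) * (m - l ^ 4) = 0"
    by algebra
  moreover have "l \<noteq> 0" "l ^ 3 * l ^ 2 = 1" "l ^ 4 * l = 1"
    using assms(1) by (auto simp: eval_nat_numeral mult_ac)
  then have "l ^ 3 = 1 / l ^ 2" "l ^ 4 = 1 / l"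
    by (simp_all add: nonzero_eq_divide_eq)
  ultimately show ?thesis
    by auto
qed

text \<open>If l and m are the eigenvalues of the two representations, nonisomorphism excludes m = l
  and m = 1 / l. This leaves m = l^2 up to inversion, which a flip of the basis absorbs.\<close>

lemma dihedral_5_rep_pair:
  fixes \<rho> \<rho>' :: "'g \<Rightarrow> 'k::{alg_closed_field, field_char_0} ^ 2 ^ 2"
  assumes irr: "irreducible_rep G \<rho>" "irreducible_rep G \<rho>'" and noniso: "\<not> isomorphic_reps G \<rho> \<rho>'"
    and h: "h \<in> iso G (dihedral_group 5)" and G: "group G"
  obtains P P' l where "invertible P" "invertible P'" "l ^ 5 = 1" "l \<noteq> 1"
    "\<And>g. g \<in> carrier G \<Longrightarrow>
      P ** \<rho> g = dihedral_mat (l powi fst (h g)) (snd (h g)) ** P"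
    "\<And>g. g \<in> carrier G \<Longrightarrow>
      P' ** \<rho>' g = dihedral_mat ((l powi fst (h g)) ^ 2) (snd (h g)) ** P'"
proof -
  define k where "k = inv_into (carrier G) h"
  have D: "group (dihedral_group 5)"
    by (rule group_dihedral_group) simp
  have k: "k \<in> iso (dihedral_group 5) G"
    using group.iso_set_sym[OF G h] by (simp add: k_def)
  have kh: "k (h g) = g" "h g \<in> {0..<5} \<times> UNIV" if "g \<in> carrier G" for g
    using that h unfolding k_def iso_def bij_betw_def by (auto simp: hom_def simp flip: dihedral_5_carrier)
  \<comment> \<open>Pulling back along the inverse of \<open>h\<close> reduces to the concrete
    dihedral group.\<close>
  have normal: "\<exists>P l. invertible P \<and> l ^ 5 = 1 \<and> l \<noteq> 1 \<and>
      (\<forall>g \<in> carrier G. P ** \<sigma> g = dihedral_mat (l powi fst (h g)) (snd (h g)) ** P)"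
    if \<sigma>: "irreducible_rep G \<sigma>" for \<sigma> :: "'g \<Rightarrow> 'k ^ 2 ^ 2"
  proof -
    have kc: "k d \<in> carrier G" if "d \<in> carrier (dihedral_group 5)" for d
      using k that by (auto simp: iso_def hom_def)
    have "linear_rep (dihedral_group 5) (\<sigma> \<circ> k)"
      using \<sigma> kc hom_one[OF _ D G, of k] k
      by (auto simp: irreducible_rep_def linear_rep_def iso_def hom_mult)
    moreover have "\<forall>g \<in> carrier G. (*v) (\<sigma> g) ` W \<subseteq> W"
      if "\<forall>d \<in> carrier (dihedral_group 5). (*v) ((\<sigma> \<circ> k) d) ` W \<subseteq> W" for W
      using that kh by (metis comp_apply dihedral_5_carrier)
    ultimately have "irreducible_rep (dihedral_group 5) (\<sigma> \<circ> k)"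
      using \<sigma> unfolding irreducible_rep_def by blast
    from dihedral_5_irreducible_rep[OF this] obtain P l where P: "invertible P" "l ^ 5 = 1" "l \<noteq> 1"
      "\<And>a b. a \<in> {0..<5} \<Longrightarrow> P ** (\<sigma> \<circ> k) (a, b) = dihedral_mat (l powi a) b ** P"
      by blast
    have "P ** \<sigma> g = dihedral_mat (l powi fst (h g)) (snd (h g)) ** P" if "g \<in> carrier G" for g
      using P(4)[of "fst (h g)" "snd (h g)"] kh[OF that] by auto
    then show ?thesis
      using P by blast
  qed
  obtain P l where P: "invertible P" "l ^ 5 = 1" "l \<noteq> 1"
    "\<And>g. g \<in> carrier G \<Longrightarrow> P ** \<rho> g = dihedral_mat (l powi fst (h g)) (snd (h g)) ** P"
    using normal[OF irr(1)] by blast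
  obtain P' m where P': "invertible P'" "m ^ 5 = 1" "m \<noteq> 1"
    "\<And>g. g \<in> carrier G \<Longrightarrow> P' ** \<rho>' g = dihedral_mat (m powi fst (h g)) (snd (h g)) ** P'"
    using normal[OF irr(2)] by blast
  have l0: "l \<noteq> 0" and m0: "m \<noteq> 0"
    using P(2) P'(2) by auto
  let ?W = "dihedral_mat (1::'k) True"
  have flip: "invertible (?W ** P')"
    "\<And>g. g \<in> carrier G \<Longrightarrow>
      (?W ** P') ** \<rho>' g = dihedral_mat ((1 / m) powi fst (h g)) (snd (h g)) ** (?W ** P')"
  proof -
    show "invertible (?W ** P')"
      using P'(1) invertible_dihedral_flip invertible_mult by blast
    fix g assume g: "g \<in> carrier G"
    have "(?W ** P') ** \<rho>' g = (?W ** dihedral_mat (m powi fst (h g)) (snd (h g))) ** P'"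
      by (simp add: matrix_mul_assoc[symmetric] P'(4)[OF g])
    also have "?W ** dihedral_mat (m powi fst (h g)) (snd (h g))
        = dihedral_mat ((1 / m) powi fst (h g)) (snd (h g)) ** ?W"
      using m0 by (simp add: dihedral_mat_flip power_int_divide_distrib)
    finally show "(?W ** P') ** \<rho>' g
        = dihedral_mat ((1 / m) powi fst (h g)) (snd (h g)) ** (?W ** P')"
      by (simp add: matrix_mul_assoc)
  qed
  have iso: "isomorphic_reps G \<rho> \<rho>'"
    if C: "invertible C" "\<And>g. g \<in> carrier G \<Longrightarrow>
        C ** \<rho>' g = dihedral_mat (l powi fst (h g)) (snd (h g)) ** C" for C
  proof -
    obtain C' where C': "C ** C' = mat 1" "C' ** C = mat 1"
      using C(1) by (auto simp: invertible_def)
    then have "invertible (C' ** P)"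
      using P(1) invertible_mult invertible_def by blast
    moreover have "(C' ** P) ** \<rho> g = \<rho>' g ** (C' ** P)" if g: "g \<in> carrier G" for g
    proof -
      have "(C' ** P) ** \<rho> g = C' ** (dihedral_mat (l powi fst (h g)) (snd (h g)) ** C) ** C' ** P"
        by (simp add: matrix_mul_assoc[symmetric] P(4)[OF g] C')
      also have "\<dots> = \<rho>' g ** (C' ** P)"
        unfolding C(2)[OF g, symmetric] by (simp add: matrix_mul_assoc C')
      finally show ?thesis .
    qed
    ultimately show ?thesis
      unfolding isomorphic_reps_def by blast
  qed
  have "m \<noteq> l" "m \<noteq> 1 / l"
    using iso[OF P'(1)] iso[OF flip(1)] P'(4) flip(2) noniso by auto
  then have m: "m = l ^ 2 \<or> m = 1 / l ^ 2"
    using fifth_roots_of_unity[OF P(2) P'(2) P(3) P'(3)] by blast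
  have sq: "(l ^ 2) powi a = (l powi a) ^ 2" for a
    by (simp add: power2_eq_square power_int_mult_distrib)
  from m show ?thesis
  proof
    assume "m = l ^ 2"
    then show ?thesis
      using that[of P P' l] P P' sq by simp
  next
    assume "m = 1 / l ^ 2"
    then show ?thesis
      using that[of P "?W ** P'" l] P flip sq by simp
  qed
qed


section \<open>The linearization\<close>

lemma sum_UNIV_sum: "(\<Sum>i\<in>UNIV. f (i :: 'a::finite + 'b::finite)) = (\<Sum>a\<in>UNIV. f (Inl a)) + (\<Sum>b\<in>UNIV. f (Inr b))"
  by (simp flip: UNIV_Plus_UNIV add: sum.Plus)

lemma direct_sum_rep_nth [simp]:
  "(\<rho> \<oplus>\<^sub>r \<sigma>) g $ Inl a $ Inl b = \<rho> g $ a $ b" "(\<rho> \<oplus>\<^sub>r \<sigma>) g $ Inl a $ Inr d = 0"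
  "(\<rho> \<oplus>\<^sub>r \<sigma>) g $ Inr c $ Inl b = 0" "(\<rho> \<oplus>\<^sub>r \<sigma>) g $ Inr c $ Inr d = \<sigma> g $ c $ d"
  by (simp_all add: direct_sum_rep_def)

text \<open>Constant families evaluated at \<open>()\<close> let the direct sum of representations
  express a block-diagonal matrix.\<close>

lemma direct_sum_rep_mult:
  "(\<rho> \<oplus>\<^sub>r \<sigma>) g ** (\<rho>' \<oplus>\<^sub>r \<sigma>') h = ((\<lambda>_. \<rho> g ** \<rho>' h) \<oplus>\<^sub>r (\<lambda>_. \<sigma> g ** \<sigma>' h)) ()"
  unfolding vec_eq_iff matrix_matrix_mult_def
  by (simp add: split_sum_all sum_UNIV_sum)

definition block_mat :: "'k::field \<Rightarrow> 'k ^ 2 ^ 2 \<Rightarrow> 'k ^ 2 ^ 2 \<Rightarrow> 'k ^ (1 + 2 + 2) ^ (1 + 2 + 2)" where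
  "block_mat a M N = ((\<lambda>_. mat a) \<oplus>\<^sub>r (\<lambda>_. M) \<oplus>\<^sub>r (\<lambda>_. N)) ()"

lemma direct_sum_rep_eq_block_mat: "(trivial_rep \<oplus>\<^sub>r \<rho> \<oplus>\<^sub>r \<rho>') g = block_mat 1 (\<rho> g) (\<rho>' g)"
  by (simp add: block_mat_def vec_eq_iff split_sum_all trivial_rep_def)

lemma block_mat_mult: "block_mat a M N ** block_mat a' M' N' = block_mat (a * a') (M ** M') (N ** N')"
  unfolding block_mat_def direct_sum_rep_mult
  by (simp add: vec_eq_iff split_sum_all mat_def matrix_matrix_mult_def)

lemma block_mat_one: "block_mat 1 (mat 1) (mat 1) = mat 1"
  by (simp add: block_mat_def vec_eq_iff split_sum_all mat_def)

lemma block_mat_mult_vec: "block_mat a M N *v mk5 x y1 y2 z1 z2 =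
    mk5 (a * x) (M $ 1 $ 1 * y1 + M $ 1 $ 2 * y2) (M $ 2 $ 1 * y1 + M $ 2 $ 2 * y2)
      (N $ 1 $ 1 * z1 + N $ 1 $ 2 * z2) (N $ 2 $ 1 * z1 + N $ 2 $ 2 * z2)"
  unfolding vec5_eq_iff
  by (simp add: block_mat_def matrix_vector_mult_def sum_UNIV_sum sum_2 mat_def)

lemma block_mat_dihedral: "block_mat 1 (dihedral_mat z b) (dihedral_mat z' b) *v mk5 x y1 y2 z1 z2 =
    (if b then mk5 x (z * y2) (y1 / z) (z' * z2) (z1 / z')
     else mk5 x (z * y1) (y2 / z) (z' * z1) (z2 / z'))"
  by (simp add: block_mat_mult_vec dihedral_mat_def)

text \<open>The action of r^a s^b on the sum of V_2 and W, for z = l^a; the last two coordinates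
  feel only the reflection.\<close>

definition linear_action :: "'k::field \<Rightarrow> bool \<Rightarrow> 'k ^ 4 ^ 4" where
  "linear_action z b = (if b
    then vector [vector [0, z, 0, 0], vector [1 / z, 0, 0, 0], vector [0, 0, 0, 1], vector [0, 0, 1, 0]]
    else vector [vector [z, 0, 0, 0], vector [0, 1 / z, 0, 0], vector [0, 0, 1, 0], vector [0, 0, 0, 1]])"

lemma linear_action_mult_vec: "linear_action z b *v u = (if b
    then vector [z * u $ 2, u $ 1 / z, u $ 4, u $ 3] else vector [z * u $ 1, u $ 2 / z, u $ 3, u $ 4])"
  by (simp add: linear_action_def vec_eq_iff matrix_vector_mult_def sum_4 forall_4)

lemma linear_rep_linear_action:
  assumes h: "h \<in> iso G (dihedral_group 5)" and G: "group G" and l: "l ^ 5 = (1 :: 'k::field)"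
  shows "linear_rep G (\<lambda>g. linear_action (l powi fst (h g)) (snd (h g)))"
proof -
  have D: "group (dihedral_group 5)"
    by (rule group_dihedral_group) simp
  have l0: "l \<noteq> 0" using l by auto
  have hom: "h \<in> hom G (dihedral_group 5)"
    using h by (simp add: iso_def)
  have "h \<one>\<^bsub>G\<^esub> = (0, False)"
    using hom_one[OF hom G D] by (simp add: dihedral_5_one)
  then have "linear_action (l powi fst (h \<one>\<^bsub>G\<^esub>)) (snd (h \<one>\<^bsub>G\<^esub>)) = mat 1"
    unfolding matrix_eq by (simp add: linear_action_mult_vec vec_eq_iff forall_4)
  moreover have "linear_action (l powi fst (h (g \<otimes>\<^bsub>G\<^esub> g'))) (snd (h (g \<otimes>\<^bsub>G\<^esub> g'))) =
      linear_action (l powi fst (h g)) (snd (h g)) ** linear_action (l powi fst (h g')) (snd (h g'))"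
    if "g \<in> carrier G" "g' \<in> carrier G" for g g'
  proof -
    obtain a b c d where hg: "h g = (a, b)" "h g' = (c, d)"
      by (metis surj_pair)
    have "h (g \<otimes>\<^bsub>G\<^esub> g') = ((if b then a - c else a + c) mod 5, b \<noteq> d)"
      using hom_mult[OF hom that] by (simp add: hg dihedral_5_mult)
    then show ?thesis
      unfolding matrix_eq matrix_vector_mul_assoc[symmetric] using l0
      by (auto simp: hg linear_action_mult_vec power_int_mod_5[OF l] power_int_add power_int_diff
          vec_eq_iff forall_4)
  qed
  ultimately show ?thesis
    by (simp add: linear_rep_def)
qed

text \<open>The square in the second block makes y2^2 z1 and y1^2 z2 invariant under rotation, so
  the last two coordinates have weight 0.\<close>

lemma quadric_to_proj_equivariant:
  assumes "z \<noteq> 0"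
  shows "quadric_to_proj (block_mat 1 (dihedral_mat z b) (dihedral_mat (z ^ 2) b) *v v)
    = linear_action z b *v quadric_to_proj v"
proof -
  obtain x y1 y2 z1 z2 where v: "v = mk5 x y1 y2 z1 z2" by (rule mk5_exhaust)
  show ?thesis
    unfolding v block_mat_dihedral linear_action_mult_vec quadric_to_proj_def Let_def
    using assms by (simp add: vec_eq_iff forall_4 power2_eq_square field_simps)
qed

text \<open>With degrees written by \<open>Suc\<close>, resolution peels off one linear factor at a
  time from a right-nested product.\<close>

lemma form_linear_times: "form 1 f \<Longrightarrow> form d g \<Longrightarrow> form (Suc d) (\<lambda>x. f x * g x)"
  using form_mult[of 1 f d g] by simp

lemma form_quadric_to_proj: "form 3 (\<lambda>v. quadric_to_proj (T *v v) $ j)"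
proof -
  have "\<forall>j. form (Suc (Suc 1)) (\<lambda>v. quadric_to_proj (T *v v) $ j)"
    unfolding forall_4 quadric_to_proj_def Let_def vector_4 mult.assoc
    by (intro conjI form_diff form_linear_times form_matrix)
  then show ?thesis
    by (simp add: eval_nat_numeral)
qed

lemma form_quadric_chart: "form 5 (\<lambda>v. quadric_chart (T *v v))"
proof -
  have "form (Suc (Suc (Suc (Suc 1)))) (\<lambda>v. quadric_chart (T *v v))"
    unfolding quadric_chart_def Let_def mult.assoc
    by (intro form_add form_diff form_linear_times form_matrix)
  then show ?thesis
    by (simp add: eval_nat_numeral)
qed

lemma form_proj_chart: "form 3 proj_chart"
proof -
  have "form (Suc (Suc 1)) proj_chart"
    unfolding proj_chart_def[abs_def] mult.assoc
    by (intro form_add form_linear_times form_coord)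
  then show ?thesis
    by (simp add: eval_nat_numeral)
qed

lemma form_proj_to_quadric: "form 4 (\<lambda>u. (T *v proj_to_quadric u) $ i)"
proof -
  have "\<forall>j. form (Suc (Suc (Suc 1))) (\<lambda>u. proj_to_quadric u $ j)"
    unfolding forall_five proj_to_quadric_def Let_def mk5_nth mult.assoc
    by (intro conjI form_add form_diff form_linear_times form_coord)
  then have "form (Suc (Suc (Suc 1))) (\<lambda>u. \<Sum>j\<in>UNIV. T $ i $ j * proj_to_quadric u $ j)"
    by (intro form_sum form_cmult) blast
  then show ?thesis
    by (simp add: matrix_vector_mult_def eval_nat_numeral)
qed

text \<open>\<open>T\<close> carries \<open>Q\<close> to the standard quadric and the action to its
  normal form; both explicit maps are conjugated by it.\<close>

lemma linearizable_std_quadric: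
  fixes T T' :: "'k::field_char_0 ^ (1 + 2 + 2) ^ (1 + 2 + 2)"
  assumes TT': "T ** T' = mat 1" "T' ** T = mat 1"
    and Q: "Q = {L \<in> proj_space. \<forall>x\<in>L. std_quadric (T *v x) = 0}"
    and h: "h \<in> iso G (dihedral_group 5)" and G: "group G" and l: "l ^ 5 = 1"
    and equiv: "\<And>g. g \<in> carrier G \<Longrightarrow> T ** \<rho> g =
      block_mat 1 (dihedral_mat (l powi fst (h g)) (snd (h g)))
        (dihedral_mat ((l powi fst (h g)) ^ 2) (snd (h g))) ** T"
  shows "linearizable G \<rho> Q"
proof -
  have T: "T *v (T' *v y) = y" "T' *v (T *v x) = x" for x y
    by (simp_all add: matrix_vector_mul_assoc TT')
  have T0: "T *v x \<noteq> 0" if "x \<noteq> 0" for x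
    using that T(2)[of x] by auto
  have l0: "l \<noteq> 0" using l by auto
  let ?q = "\<lambda>x. std_quadric (T *v x)" and ?h = "\<lambda>x. quadric_chart (T *v x)"
  have quad: "quadratic_form ?q (\<lambda>x y. std_polar (T *v x) (T *v y))"
    by (rule quadratic_form.matrix[OF quadratic_form_std])
  have span_Q: "vec.span {x} \<in> Q \<longleftrightarrow> ?q x = 0" if "x \<noteq> 0" for x
    using that quadratic_form.scale[OF quad]
    by (auto simp: Q proj_space_iff vec.span_base vec.span_singleton)
  have "equivariantly_birational G \<rho> Q (\<lambda>g. linear_action (l powi fst (h g)) (snd (h g))) proj_space"
  proof (rule equivariantly_birationalI[OF _ subset_refl form_quadric_chart form_proj_chart _ _
        form_quadric_to_proj form_proj_to_quadric])
    show "dense_open_in Q (Q \<inter> nonvanishing ?h)"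
    proof (rule dense_open_in_quadric[OF quad form_quadric_chart Q])
      fix p assume p: "?q p = 0" "p \<noteq> 0"
      show "\<exists>w. std_polar (T *v p) (T *v w) = 0 \<and> ?q w \<noteq> 0"
        using std_quadric_orthogonal_anisotropic[OF p(1) T0[OF p(2)]] T(1) by metis
      show "\<exists>u. ?q u = 0 \<and> std_polar (T *v p) (T *v u) \<noteq> 0 \<and> ?h u \<noteq> 0"
        using std_quadric_nondegenerate_chart[OF T0[OF p(2)]] T(1) by metis
    qed
    show "dense_open_in (proj_space :: ('k ^ 4) set set) (proj_space \<inter> nonvanishing proj_chart)"
      by (rule dense_open_in_proj_space[OF form_proj_chart, of "vector [1, 1, 1, 1]"])
        (simp_all add: proj_chart_def vec_eq_iff forall_4)
  next
    fix x assume x: "x \<noteq> 0" "vec.span {x} \<in> Q" "?h x \<noteq> 0"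
    obtain c where c: "c \<noteq> 0" "proj_to_quadric (quadric_to_proj (T *v x)) = c *s (T *v x)"
      using proj_to_quadric_to_proj[of "T *v x"] x span_Q by blast
    have "proj_chart (quadric_to_proj (T *v x)) \<noteq> 0"
      using x(3) by (rule proj_chart_quadric_to_proj)
    moreover from this have "quadric_to_proj (T *v x) \<noteq> 0"
      by (auto simp: proj_chart_def)
    moreover have "T' *v proj_to_quadric (quadric_to_proj (T *v x)) = c *s x"
      by (simp add: c vector_scalar_commute T)
    ultimately show "quadric_to_proj (T *v x) \<noteq> 0 \<and> vec.span {quadric_to_proj (T *v x)} \<in> proj_space \<and>
        proj_chart (quadric_to_proj (T *v x)) \<noteq> 0 \<and>
        (\<exists>c. c \<noteq> 0 \<and> T' *v proj_to_quadric (quadric_to_proj (T *v x)) = c *s x)"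
      using c(1) by (auto simp: proj_space_iff)
  next
    fix y :: "'k ^ 4" assume y: "proj_chart y \<noteq> 0"
    let ?x = "T' *v proj_to_quadric y"
    have "quadric_chart (proj_to_quadric y) \<noteq> 0"
      using y by (rule quadric_chart_proj_to_quadric)
    moreover from this have "proj_to_quadric y \<noteq> 0"
      by (auto simp: quadric_chart_def)
    then have "?x \<noteq> 0"
      using T(1)[of "proj_to_quadric y"] by auto
    moreover from this have "vec.span {?x} \<in> Q"
      by (simp add: span_Q T std_quadric_proj_to_quadric)
    moreover have "(y $ 1 * y $ 2) ^ 4 * (y $ 3 + y $ 4) ^ 3 \<noteq> 0"
      using y by (auto simp: proj_chart_def)
    ultimately show "?x \<noteq> 0 \<and> vec.span {?x} \<in> Q \<and> ?h ?x \<noteq> 0 \<and>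
        (\<exists>c. c \<noteq> 0 \<and> quadric_to_proj (T *v ?x) = c *s y)"
      using quadric_to_proj_to_quadric[of y] unfolding T by blast
  next
    fix g x assume "g \<in> carrier G"
    then show "quadric_to_proj (T *v (\<rho> g *v x)) =
        linear_action (l powi fst (h g)) (snd (h g)) *v quadric_to_proj (T *v x)"
      using l0 by (simp add: matrix_vector_mul_assoc equiv)
        (simp add: quadric_to_proj_equivariant flip: matrix_vector_mul_assoc)
  qed (auto simp: Q)
  then show ?thesis
    unfolding linearizable_def using linear_rep_linear_action[OF h G l] by blast
qed

theorem lemma6p2:
  fixes G :: "('g, 'z) monoid_scheme"
    and \<rho> \<rho>' :: "'g \<Rightarrow> 'k::{alg_closed_field, field_char_0} ^ 2 ^ 2"
    and Q :: "('k ^ (1 + 2 + 2)) set set"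
  assumes "group G" and "G \<cong> dihedral_group 5"
    and "irreducible_rep G \<rho>" and "irreducible_rep G \<rho>'"
    and "\<not> isomorphic_reps G \<rho> \<rho>'"
    and "smooth_quadric Q"
    and "invariant_under G (trivial_rep \<oplus>\<^sub>r \<rho> \<oplus>\<^sub>r \<rho>') Q"
  shows "linearizable G (trivial_rep \<oplus>\<^sub>r \<rho> \<oplus>\<^sub>r \<rho>') Q"
proof -
  obtain h where h: "h \<in> iso G (dihedral_group 5)"
    using assms(2) by (auto simp: is_iso_def)
  obtain P P' l where P: "invertible P" "invertible P'" and l: "l ^ 5 = 1" "l \<noteq> 1"
    and PG: "\<And>g. g \<in> carrier G \<Longrightarrow>
      P ** \<rho> g = dihedral_mat (l powi fst (h g)) (snd (h g)) ** P"
    and PG': "\<And>g. g \<in> carrier G \<Longrightarrow>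
      P' ** \<rho>' g = dihedral_mat ((l powi fst (h g)) ^ 2) (snd (h g)) ** P'"
    using dihedral_5_rep_pair[OF assms(3,4,5) h assms(1)] by blast
  obtain P1 P1' where P1: "P ** P1 = mat 1" "P1 ** P = mat 1" "P' ** P1' = mat 1" "P1' ** P' = mat 1"
    using P by (auto simp: invertible_def)
  let ?\<rho> = "trivial_rep \<oplus>\<^sub>r \<rho> \<oplus>\<^sub>r \<rho>'"
  define A where "A z b = block_mat 1 (dihedral_mat z b) (dihedral_mat (z ^ 2) b)" for z :: 'k and b
  define T T' where "T = block_mat 1 P P'" "T' = block_mat 1 P1 P1'"
  have TT': "T ** T' = mat 1" "T' ** T = mat 1"
    by (simp_all add: T_T'_def block_mat_mult P1 block_mat_one)
  have TG: "T ** ?\<rho> g = A (l powi fst (h g)) (snd (h g)) ** T" if "g \<in> carrier G" for g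
    by (simp add: direct_sum_rep_eq_block_mat T_T'_def A_def block_mat_mult PG[OF that] PG'[OF that])
  obtain F where F: "homogeneous 2 F" "Q = proj_zero_set F"
    "\<And>x. x \<noteq> 0 \<Longrightarrow> eval_mvpoly F x = 0 \<Longrightarrow> \<exists>i. eval_mvpoly (partial_mvpoly i F) x \<noteq> 0"
    using assms(6) unfolding smooth_quadric_def by blast
  obtain B where B: "quadratic_form (eval_mvpoly F) B"
    "\<And>x i. eval_mvpoly (partial_mvpoly i F) x = B x (axis i 1)"
    using quadratic_form_eval_mvpoly[OF F(1)] by blast
  \<comment> \<open>Invariance of the point set yields only this implication on zeros; the scalar is
    recovered in \<open>invariant_quadratic_form\<close>.\<close>
  have zero_inv: "eval_mvpoly F (?\<rho> g *v x) = 0" if g: "g \<in> carrier G" and x: "eval_mvpoly F x = 0" for g x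
  proof (cases "x = 0")
    case False
    then have "vec.span {x} \<in> Q"
      using x quadratic_form.scale[OF B(1)] by (auto simp: F(2) proj_zero_set_def proj_space_iff vec.span_singleton)
    then have "proj_action (?\<rho> g) (vec.span {x}) \<in> Q"
      using assms(7) g by (auto simp: invariant_under_def)
    then show ?thesis
      by (auto simp: F(2) proj_zero_set_def proj_action_def vec.span_base)
  qed (simp add: quadratic_form.zero[OF B(1)])
  let ?q = "\<lambda>y. eval_mvpoly F (T' *v y)"
  have T: "T *v (T' *v y) = y" "T' *v (T *v y) = y" for y
    by (simp_all add: matrix_vector_mul_assoc TT')
  have inv: "?q (A (l powi fst d) (snd d) *v y) = 0" if "d \<in> carrier (dihedral_group 5)" "?q y = 0" for d y
  proof -
    have "d \<in> h ` carrier G"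
      using h that(1) by (simp add: iso_def bij_betw_def)
    then obtain g where g: "g \<in> carrier G" "h g = d"
      by blast
    have "T' *v (A (l powi fst d) (snd d) *v y) = T' *v ((A (l powi fst d) (snd d) ** T) *v (T' *v y))"
      by (simp add: T flip: matrix_vector_mul_assoc)
    also have "\<dots> = ?\<rho> g *v (T' *v y)"
      unfolding TG[OF g(1), unfolded g(2), symmetric] by (simp add: T flip: matrix_vector_mul_assoc)
    finally show ?thesis
      using zero_inv[OF g(1) that(2)] by simp
  qed
  obtain a b c where abc: "a \<noteq> 0" "b \<noteq> 0" "c \<noteq> 0"
    "\<And>x y1 y2 z1 z2. ?q (mk5 x y1 y2 z1 z2) = a * x ^ 2 + b * (y1 * y2) + c * (z1 * z2)"
  proof (rule invariant_quadratic_form[OF quadratic_form.matrix[OF B(1)] _ l])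
    fix y assume "?q y = 0" "y \<noteq> 0"
    moreover from this have "T' *v y \<noteq> 0"
      using T(1)[of y] by auto
    ultimately obtain i where "B (T' *v y) (axis i 1) \<noteq> 0"
      using F(3) B(2) by metis
    then have "B (T' *v y) (T' *v (T *v axis i 1)) \<noteq> 0"
      by (simp add: T)
    then show "\<exists>y'. B (T' *v y) (T' *v y') \<noteq> 0" by blast
  next
    show "A l False *v mk5 x y1 y2 z1 z2 = mk5 x (l * y1) (y2 / l) (l ^ 2 * z1) (z2 / l ^ 2)" for x y1 y2 z1 z2
      by (simp add: A_def block_mat_dihedral)
    show "A 1 True *v mk5 x y1 y2 z1 z2 = mk5 x y2 y1 z2 z1" for x y1 y2 z1 z2
      by (simp add: A_def block_mat_dihedral)
    show "?q (A l False *v y) = 0" if "?q y = 0" for y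
      using inv[of "(1, False)" y] that by (simp add: dihedral_5_carrier)
    show "?q (A 1 True *v y) = 0" if "?q y = 0" for y
      using inv[of "(0, True)" y] that by (simp add: dihedral_5_carrier)
  qed blast
  \<comment> \<open>Square roots bring the form to x^2 - y1 y2 - z1 z2, hence the minus
    signs.\<close>
  obtain s t u where stu: "s ^ 2 = a" "t ^ 2 = - b" "u ^ 2 = - c"
    using nth_root_exists[of 2 a] nth_root_exists[of 2 "- b"] nth_root_exists[of 2 "- c"] by auto
  then have stu0: "s \<noteq> 0" "t \<noteq> 0" "u \<noteq> 0"
    using abc by auto
  define C C' where "C = block_mat s (mat t) (mat u)" "C' = block_mat (1 / s) (mat (1 / t)) (mat (1 / u))"
  have mat_mult: "mat v ** M = M ** mat v" "mat v ** mat w = (mat (v * w) :: 'k ^ 2 ^ 2)"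
    for v w :: 'k and M :: "'k ^ 2 ^ 2"
    unfolding vec_eq_iff forall_2 by (simp_all add: matrix_matrix_mult_def sum_2 mat_def)
  have CC': "C ** C' = mat 1" "C' ** C = mat 1"
    using stu0 by (simp_all add: C_C'_def block_mat_mult mat_mult(2) block_mat_one)
  \<comment> \<open>\<open>C\<close> acts by one scalar on each summand, so rescaling does not
    disturb the action.\<close>
  have CA: "C ** A z b = A z b ** C" for z b
    by (simp add: C_C'_def A_def block_mat_mult mat_mult(1))
  have eval: "eval_mvpoly F x = std_quadric ((C ** T) *v x)" for x
  proof -
    obtain x0 y1 y2 z1 z2 where y: "T *v x = mk5 x0 y1 y2 z1 z2" by (rule mk5_exhaust)
    have "eval_mvpoly F x = ?q (mk5 x0 y1 y2 z1 z2)"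
      by (simp add: T flip: y)
    also have "\<dots> = s ^ 2 * x0 ^ 2 - t ^ 2 * (y1 * y2) - u ^ 2 * (z1 * z2)"
      unfolding abc(4) stu by simp
    also have "\<dots> = std_quadric (C *v mk5 x0 y1 y2 z1 z2)"
      by (simp add: C_C'_def block_mat_mult_vec std_quadric_def mat_def power2_eq_square)
    finally show ?thesis
      by (simp add: y flip: matrix_vector_mul_assoc)
  qed
  show ?thesis
  proof (rule linearizable_std_quadric[OF _ _ _ h assms(1) l(1)])
    show "(C ** T) ** (T' ** C') = mat 1" "(T' ** C') ** (C ** T) = mat 1"
      by (metis CC' TT' matrix_mul_assoc matrix_mul_lid)+
    show "Q = {L \<in> proj_space. \<forall>x\<in>L. std_quadric ((C ** T) *v x) = 0}"
      by (simp add: F(2) proj_zero_set_def eval)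
    show "(C ** T) ** ?\<rho> g = block_mat 1 (dihedral_mat (l powi fst (h g)) (snd (h g)))
        (dihedral_mat ((l powi fst (h g)) ^ 2) (snd (h g))) ** (C ** T)" if "g \<in> carrier G" for g
      by (simp add: TG[OF that] CA flip: A_def matrix_mul_assoc) (simp add: CA matrix_mul_assoc)
  qed
qed

end
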